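(* Let $d\ge 1$, $\gamma\in\mathbb{R}$, and let $\mathbf{X}\sim\mathrm{CSC}_d(\gamma)$. Then for every $\alpha\in(0,0.5]$, $$Q_\alpha=\left\{\mathbf{x}\in\mathbb{R}^d:\ (x_1-s(\alpha))^2+\sum_{i=2}^d x_i^2\le t(\alpha)^2\right\},$$ where $$s(\alpha)=\frac{\gamma}{\sqrt{1+\gamma^2}}\sec\left\{\left(\tfrac12-\alpha\right)\pi\right\}\quad\text{and}\quad t(\alpha)=\tan\left\{\left(\tfrac12-\alpha\right)\pi\right\}.$$
   Context: Canonical skew-Cauchy distribution: for $\gamma\in\mathbb{R}$, $\mathbf{X}\sim\mathrm{CSC}_d(\gamma)$ means that the random vector $\mathbf{X}$ in $\mathbb{R}^d$ has density $$f(\mathbf{x})=2\,\frac{\Gamma((1+d)/2)}{\pi^{d/2}\Gamma(1/2)}\left(1+\|\mathbf{x}\|^2\right)^{-(1+d)/2}T_1\!\left(\gamma x_1\left(\frac{1+d}{\|\mathbf{x}\|^2+1}\right)^{1/2};1+d\right),\qquad \mathbf{x}\in\mathbb{R}^d,$$ where $\|\cdot\|$ is the Euclidean norm and $T_1(\cdot;m)$ is the distribution function of the univariate Student $t$ distribution with $m$ degrees of freedom. Depth set: for $\mathbf{y}\in\mathbb{R}^d$ and $\mathbf{u}\in\mathbb{R}^d\setminus\{\mathbf{0}\}$ let $H_{\mathbf{y},\mathbf{u}}=\{\mathbf{x}\in\mathbb{R}^d:\mathbf{u}^\top\mathbf{x}\le\mathbf{u}^\top\mathbf{y}\}$. For $\alpha\in(0,0.5]$,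 $Q_\alpha$ is the intersection of all half-spaces $H_{\mathbf{y},\mathbf{u}}$ with $P(\mathbf{X}\in H_{\mathbf{y},\mathbf{u}})\ge 1-\alpha$. Equivalently, $Q_\alpha=\{\mathbf{x}:\mathbf{u}^\top\mathbf{x}\le q_{1-\alpha}(\mathbf{u})\ \text{for all } \mathbf{u}\in\mathbb{R}^d\setminus\{\mathbf{0}\}\}$, where $q_\theta(\mathbf{u})$ is the $\theta$-quantile of $\mathbf{u}^\top\mathbf{X}$. *)

theory Defs
  imports "HOL-Probability.Probability"
begin

definition student_t_density :: "real \<Rightarrow> real \<Rightarrow> real" where
  "student_t_density m x =
     Gamma ((m + 1) / 2) / (sqrt (m * pi) * Gamma (m / 2)) *
     (1 + x\<^sup>2 / m) powr (- ((m + 1) / 2))"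

text \<open>\<open>student_t_cdf m x\<close> is \<open>T\<^sub>1(x; m)\<close>: the degrees of freedom come first.\<close>

definition student_t_cdf :: "real \<Rightarrow> real \<Rightarrow> real" where
  "student_t_cdf m = cdf (density lborel (\<lambda>x. ennreal (student_t_density m x)))"

text \<open>
  The space \<open>\<real>\<^sup>d\<close> is \<^typ>\<open>real ^ 'n\<close> with \<open>d = CARD('n) \<ge> 1\<close>. Elements of \<open>'n\<close> carry no order, so the
  index \<open>k\<close> names the coordinate that is written \<open>x\<^sub>1\<close> in the usual notation; the other
  coordinates \<open>x\<^sub>2, \<dots>, x\<^sub>d\<close> are those with index in \<open>UNIV - {k}\<close>.
\<close>

definition csc_density :: "'n::finite \<Rightarrow> real \<Rightarrow> real ^ 'n \<Rightarrow> real" where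
  "csc_density k \<gamma> x =
     (let d = real CARD('n) in
        2 * (Gamma ((1 + d) / 2) / (pi powr (d / 2) * Gamma (1 / 2))) *
        (1 + (norm x)\<^sup>2) powr (- ((1 + d) / 2)) *
        student_t_cdf (1 + d) (\<gamma> * x $ k * sqrt ((1 + d) / ((norm x)\<^sup>2 + 1))))"

definition halfspace :: "'a::euclidean_space \<Rightarrow> 'a \<Rightarrow> 'a set" where
  "halfspace y u = {x. u \<bullet> x \<le> u \<bullet> y}"

definition depth_set :: "'w measure \<Rightarrow> ('w \<Rightarrow> 'a::euclidean_space) \<Rightarrow> real \<Rightarrow> 'a set" where
  "depth_set M X \<alpha> =
     \<Inter> {halfspace y u | y u. u \<noteq> 0 \<and> \<P>(\<omega> in M. X \<omega> \<in> halfspace y u) \<ge> 1 - \<alpha>}"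

end

theory Submission
  imports Defs "HOL-Real_Asymp.Real_Asymp"
begin

text \<open>
  The skewing factor \<open>T\<^sub>1\<close> is the conditional probability that the last coordinate \<open>W\<close> of a spherical Cauchy
  vector \<open>(Z, W)\<close> in \<open>d + 1\<close> dimensions satisfies \<open>W \<le> \<gamma> Z\<^sub>1\<close>, given \<open>Z\<close>. Hence
  \<open>P(u\<^sup>T X \<le> c) = 2 P(u\<^sup>T Z \<le> c, W \<le> \<gamma> Z\<^sub>1)\<close>. A spherical Cauchy law is a Gamma mixture of Gaussian laws,
  for which coordinates factor and rotations are harmless; so for a unit vector \<open>u\<close> everything reduces to a
  planar Cauchy vector \<open>(A, H)\<close> and the event \<open>A \<ge> 0, \<rho> A + sqrt (1 - \<rho>\<^sup>2) H \<le> c\<close>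
  with \<open>\<rho> = u\<^sub>1 \<gamma> / sqrt (1 + \<gamma>\<^sup>2)\<close>. Its probability gives
  \<open>P(u\<^sup>T X \<le> c) = (arctan c + arccos (\<rho> / sqrt (1 + c\<^sup>2))) / \<pi>\<close>, whose quantile at level
  \<open>1 - \<alpha> = 1 / 2 + \<theta> / \<pi>\<close> is \<open>\<rho> sec \<theta> + tan \<theta>\<close>. This is the support function, at \<open>u\<close>, of the ball with
  centre \<open>(s(\<alpha>), 0, \<dots>, 0)\<close> and radius \<open>t(\<alpha>)\<close>.
\<close>

section \<open>Rotation invariance of planar Lebesgue measure\<close>

text \<open>For nonzero \<open>c\<close> a rotation is a composition of two one-dimensional affine
  substitutions: at fixed \<open>a\<close>, \<open>b\<close> is traded for
  \<open>y = s * a + c * b\<close>, which makes the first argument \<open>(a - s * y) / c\<close>;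
  then, at fixed \<open>y\<close>, \<open>a\<close> is traded for that first argument. The two
  Jacobians cancel. For \<open>c = 0\<close> the rotation only swaps the axes up to sign.\<close>

lemma nn_integral_lborel_rotation:
  fixes f :: "real \<Rightarrow> real \<Rightarrow> ennreal" and c s :: real
  assumes [measurable]: "case_prod f \<in> borel_measurable (borel \<Otimes>\<^sub>M borel)"
    and cs: "c\<^sup>2 + s\<^sup>2 = 1"
  shows "(\<integral>\<^sup>+x. \<integral>\<^sup>+y. f x y \<partial>lborel \<partial>lborel) =
         (\<integral>\<^sup>+a. \<integral>\<^sup>+b. f (c * a - s * b) (s * a + c * b) \<partial>lborel \<partial>lborel)"
proof (cases "c = 0")
  case True
  then have s: "s * s = 1" "\<bar>s\<bar> = 1" "s \<noteq> 0"
    using cs by (auto simp: power2_eq_square abs_square_eq_1 simp flip: power2_eq_square)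
  have "(\<integral>\<^sup>+a. \<integral>\<^sup>+b. f (c * a - s * b) (s * a + c * b) \<partial>lborel \<partial>lborel)
      = (\<integral>\<^sup>+b. \<integral>\<^sup>+a. f (- (s * b)) (s * a) \<partial>lborel \<partial>lborel)"
    by (subst lborel_pair.Fubini') (simp_all add: True)
  also have "\<dots> = (\<integral>\<^sup>+b. \<integral>\<^sup>+y. f (- (s * b)) y \<partial>lborel \<partial>lborel)"
    by (rule nn_integral_cong, subst (2) nn_integral_real_affine[where t=0 and c=s])
       (use s in auto)
  also have "\<dots> = (\<integral>\<^sup>+x. \<integral>\<^sup>+y. f x y \<partial>lborel \<partial>lborel)"
    by (subst (3) nn_integral_real_affine[where t=0 and c="-s"])
       (use s in auto)
  finally show ?thesis ..
next
  case False
  have "(\<integral>\<^sup>+a. \<integral>\<^sup>+b. f (c * a - s * b) (s * a + c * b) \<partial>lborel \<partial>lborel)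
      = (\<integral>\<^sup>+a. \<integral>\<^sup>+y. ennreal (1 / \<bar>c\<bar>) * f ((a - s * y) / c) y \<partial>lborel \<partial>lborel)"
  proof (rule nn_integral_cong)
    fix a :: real
    have *: "c * a - s * (y - s * a) / c = (a - s * y) / c" for y
    proof -
      have "c * a - s * (y - s * a) / c = ((c\<^sup>2 + s\<^sup>2) * a - s * y) / c"
        using False by (simp add: field_simps power2_eq_square)
      then show ?thesis by (simp add: cs)
    qed
    show "(\<integral>\<^sup>+b. f (c * a - s * b) (s * a + c * b) \<partial>lborel)
      = (\<integral>\<^sup>+y. ennreal (1 / \<bar>c\<bar>) * f ((a - s * y) / c) y \<partial>lborel)"
      by (subst nn_integral_real_affine[where t="- (s * a) / c" and c="1/c"])
         (use False * in \<open>auto simp: nn_integral_cmult field_simps\<close>)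
  qed
  also have "\<dots> = (\<integral>\<^sup>+y. \<integral>\<^sup>+a. ennreal (1 / \<bar>c\<bar>) * f ((a - s * y) / c) y \<partial>lborel \<partial>lborel)"
    by (subst lborel_pair.Fubini') simp_all
  also have "\<dots> = (\<integral>\<^sup>+y. \<integral>\<^sup>+x. f x y \<partial>lborel \<partial>lborel)"
  proof (rule nn_integral_cong)
    fix y :: real
    show "(\<integral>\<^sup>+a. ennreal (1 / \<bar>c\<bar>) * f ((a - s * y) / c) y \<partial>lborel) = (\<integral>\<^sup>+x. f x y \<partial>lborel)"
      by (subst (2) nn_integral_real_affine[where t="- (s * y) / c" and c="1/c"])
         (use False in \<open>auto simp: nn_integral_cmult field_simps\<close>)
  qed
  also have "\<dots> = (\<integral>\<^sup>+x. \<integral>\<^sup>+y. f x y \<partial>lborel \<partial>lborel)"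
    by (subst lborel_pair.Fubini') simp_all
  finally show ?thesis ..
qed

section \<open>Gaussian products and linear forms\<close>

text \<open>The density of \<open>N(0, 1 / (2 t))\<close>: here \<open>t\<close> is the Gamma mixing variable, not a variance.\<close>

definition gauss :: "real \<Rightarrow> real \<Rightarrow> ennreal" where
  "gauss t x = ennreal (sqrt (t / pi) * exp (- (t * x\<^sup>2)))"

lemma measurable_gauss [measurable]: "gauss t \<in> borel_measurable borel"
  unfolding gauss_def[abs_def] by measurable

lemma measurable_gauss2 [measurable (raw)]:
  assumes [measurable]: "f \<in> borel_measurable M" "g \<in> borel_measurable M"
  shows "(\<lambda>x. gauss (f x) (g x)) \<in> borel_measurable M"
  unfolding gauss_def by measurable

lemma nn_integral_gauss:
  assumes "t > 0"
  shows "(\<integral>\<^sup>+x. gauss t x \<partial>lborel) = 1"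
proof -
  have "(\<integral>\<^sup>+x. gauss t x \<partial>lborel) = (\<integral>\<^sup>+x. ennreal (normal_density 0 (1 / sqrt (2 * t)) x) \<partial>lborel)"
    using assms by (auto simp: gauss_def normal_density_def power_divide real_sqrt_divide real_sqrt_mult power_mult_distrib
        intro!: nn_integral_cong)
  also have "\<dots> = 1"
    using assms by (subst nn_integral_eq_integral) (auto simp: normal_density_nonneg)
  finally show ?thesis .
qed

lemma gauss_mult:
  assumes "t \<ge> 0"
  shows "gauss t x * gauss t y = ennreal (t / pi * exp (- (t * (x\<^sup>2 + y\<^sup>2))))"
proof -
  have "sqrt (t / pi) * exp (- (t * x\<^sup>2)) * (sqrt (t / pi) * exp (- (t * y\<^sup>2)))
      = (sqrt (t / pi) * sqrt (t / pi)) * (exp (- (t * x\<^sup>2)) * exp (- (t * y\<^sup>2)))"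
    by (simp only: mult_ac)
  also have "\<dots> = t / pi * exp (- (t * (x\<^sup>2 + y\<^sup>2)))"
    using assms by (simp only: real_sqrt_mult_self mult_exp_exp) (simp add: algebra_simps)
  finally show ?thesis
    using assms by (simp add: gauss_def ennreal_mult[symmetric])
qed

text \<open>The Gaussian weight depends on the point only through the sum of squares, which a
  rotation preserves, so only \<open>g\<close> sees the rotation.\<close>

lemma nn_integral_gauss_rotation:
  fixes g :: "real \<Rightarrow> real \<Rightarrow> ennreal"
  assumes [measurable]: "case_prod g \<in> borel_measurable (borel \<Otimes>\<^sub>M borel)"
    and cs: "c\<^sup>2 + s\<^sup>2 = 1" and t: "t \<ge> 0"
  shows "(\<integral>\<^sup>+x. \<integral>\<^sup>+y. gauss t x * gauss t y * g x y \<partial>lborel \<partial>lborel) =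
         (\<integral>\<^sup>+a. \<integral>\<^sup>+b. gauss t a * gauss t b * g (c * a - s * b) (s * a + c * b) \<partial>lborel \<partial>lborel)"
proof -
  have "(c * a - s * b)\<^sup>2 + (s * a + c * b)\<^sup>2 = a\<^sup>2 + b\<^sup>2" for a b
  proof -
    have "(c * a - s * b)\<^sup>2 + (s * a + c * b)\<^sup>2 = (c\<^sup>2 + s\<^sup>2) * (a\<^sup>2 + b\<^sup>2)"
      by algebra
    then show ?thesis using cs by simp
  qed
  then have "gauss t (c * a - s * b) * gauss t (s * a + c * b) = gauss t a * gauss t b" for a b
    using t by (simp add: gauss_mult)
  then show ?thesis
    by (subst nn_integral_lborel_rotation[OF _ cs]) simp_all
qed

text \<open>Stability of the Gaussian law: with \<open>r = sqrt (p^2 + q^2)\<close>, rotating the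
  first axis onto the direction of \<open>(p / r, q / r)\<close> turns \<open>p * x + q * y\<close>
  into \<open>r * a\<close>, and the other coordinate integrates to 1. For \<open>r = 0\<close> the
  argument of \<open>g\<close> is constantly 0.\<close>

lemma nn_integral_gauss_merge:
  fixes g :: "real \<Rightarrow> ennreal"
  assumes [measurable]: "g \<in> borel_measurable borel" and t: "t > 0"
  shows "(\<integral>\<^sup>+x. \<integral>\<^sup>+y. gauss t x * gauss t y * g (p * x + q * y) \<partial>lborel \<partial>lborel) =
         (\<integral>\<^sup>+h. gauss t h * g (sqrt (p\<^sup>2 + q\<^sup>2) * h) \<partial>lborel)"
proof -
  define r where "r = sqrt (p\<^sup>2 + q\<^sup>2)"
  have r2: "r\<^sup>2 = p\<^sup>2 + q\<^sup>2" by (simp add: r_def)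
  show ?thesis
  proof (cases "r = 0")
    case True
    then have "p = 0" "q = 0" using r2 by auto
    then show ?thesis
      using t by (simp add: nn_integral_cmult nn_integral_multc nn_integral_gauss mult.assoc)
  next
    case False
    have cs: "(p / r)\<^sup>2 + (q / r)\<^sup>2 = 1"
      using False by (simp add: power_divide r2[symmetric] flip: add_divide_distrib)
    have eq: "p * (p * a / r - q * b / r) + q * (q * a / r + p * b / r) = r * a" for a b
    proof -
      have "p * (p * a / r - q * b / r) + q * (q * a / r + p * b / r) = (p\<^sup>2 + q\<^sup>2) * a / r"
        using False by (simp add: field_simps power2_eq_square)
      also have "\<dots> = r * a" using False by (simp only: r2[symmetric]) (simp add: power2_eq_square)
      finally show ?thesis .
    qed
    have "(\<integral>\<^sup>+x. \<integral>\<^sup>+y. gauss t x * gauss t y * g (p * x + q * y) \<partial>lborel \<partial>lborel) =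
      (\<integral>\<^sup>+a. \<integral>\<^sup>+b. gauss t a * gauss t b * g (r * a) \<partial>lborel \<partial>lborel)"
      by (subst nn_integral_gauss_rotation[OF _ cs]) (use t in \<open>simp_all add: eq\<close>)
    also have "\<dots> = (\<integral>\<^sup>+a. (gauss t a * g (r * a)) * (\<integral>\<^sup>+b. gauss t b \<partial>lborel) \<partial>lborel)"
      by (subst nn_integral_cmult[symmetric]) (auto intro!: nn_integral_cong simp: mult_ac)
    finally show ?thesis using t by (simp add: nn_integral_gauss r_def)
  qed
qed

text \<open>Coordinates are merged one at a time, and the squares of their coefficients accumulate
  under the root.\<close>

lemma nn_integral_gauss_sum_PiM:
  fixes w :: "'i \<Rightarrow> real" and g :: "real \<Rightarrow> ennreal"
  assumes "finite I" and [measurable]: "g \<in> borel_measurable borel" and t: "t > 0"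
  shows "(\<integral>\<^sup>+x. (\<Prod>i\<in>I. gauss t (x i)) * g (\<Sum>i\<in>I. w i * x i) \<partial>Pi\<^sub>M I (\<lambda>_. lborel)) =
         (\<integral>\<^sup>+h. gauss t h * g (sqrt (\<Sum>i\<in>I. (w i)\<^sup>2) * h) \<partial>lborel)"
  using assms(1,2)
proof (induction I arbitrary: g rule: finite_induct)
  interpret product_sigma_finite "\<lambda>_::'i. lborel :: real measure" by standard
  case empty
  then show ?case
    using t by (simp add: PiM_empty nn_integral_count_space_finite nn_integral_multc nn_integral_gauss)
next
  interpret product_sigma_finite "\<lambda>_::'i. lborel :: real measure" by standard
  case (insert j I)
  note [measurable] = insert.prems
  have [simp]: "finite I" "j \<notin> I" by fact+
  have upd: "(\<Prod>i\<in>I. gauss t (if i = j then y else x i)) = (\<Prod>i\<in>I. gauss t (x i))"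
      "(\<Sum>i\<in>I. w i * (if i = j then y else x i)) = (\<Sum>i\<in>I. w i * x i)" for x y
    by (intro prod.cong sum.cong; use insert.hyps in auto)+
  let ?\<tau> = "sqrt (\<Sum>i\<in>I. (w i)\<^sup>2)"
  have "(\<integral>\<^sup>+x. (\<Prod>i\<in>insert j I. gauss t (x i)) * g (\<Sum>i\<in>insert j I. w i * x i)
            \<partial>Pi\<^sub>M (insert j I) (\<lambda>_. lborel))
      = (\<integral>\<^sup>+x. \<integral>\<^sup>+y. gauss t y * (\<Prod>i\<in>I. gauss t (x i)) * g (w j * y + (\<Sum>i\<in>I. w i * x i))
            \<partial>lborel \<partial>Pi\<^sub>M I (\<lambda>_. lborel))"
    by (subst product_nn_integral_insert) (simp_all add: upd)
  also have "\<dots> = (\<integral>\<^sup>+x. (\<Prod>i\<in>I. gauss t (x i)) *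
           (\<integral>\<^sup>+y. gauss t y * g (w j * y + (\<Sum>i\<in>I. w i * x i)) \<partial>lborel) \<partial>Pi\<^sub>M I (\<lambda>_. lborel))"
    by (subst nn_integral_cmult[symmetric]) (auto intro!: nn_integral_cong simp: mult_ac)
  \<comment> \<open>The average over the new coordinate \<open>y\<close> is a function of the sum
    over \<open>I\<close> alone, so the induction hypothesis applies with this average in the role
    of \<open>g\<close>; hence \<open>g\<close> is kept arbitrary.\<close>
  also have "\<dots> = (\<integral>\<^sup>+h. gauss t h * (\<integral>\<^sup>+y. gauss t y * g (w j * y + ?\<tau> * h) \<partial>lborel) \<partial>lborel)"
    by (rule insert.IH[where g = "\<lambda>z. \<integral>\<^sup>+y. gauss t y * g (w j * y + z) \<partial>lborel"]) measurable
  also have "\<dots> = (\<integral>\<^sup>+h. \<integral>\<^sup>+y. gauss t h * gauss t y * g (?\<tau> * h + w j * y) \<partial>lborel \<partial>lborel)"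
    by (subst nn_integral_cmult[symmetric]) (auto intro!: nn_integral_cong simp: mult_ac add_ac)
  also have "\<dots> = (\<integral>\<^sup>+h. gauss t h * g (sqrt (?\<tau>\<^sup>2 + (w j)\<^sup>2) * h) \<partial>lborel)"
    by (rule nn_integral_gauss_merge) (use t in auto)
  finally show ?case by (simp add: sum_nonneg add.commute)
qed

text \<open>The integrand sees only the coordinate along \<open>e\<close> and the linear form given
  by \<open>u\<close>. The former is kept as \<open>y\<close>; all others enter through the part of
  \<open>u\<close> orthogonal to \<open>e\<close> and merge into a single Gaussian \<open>h\<close>,
  scaled by the norm of that part.\<close>

lemma nn_integral_gauss_reduce:
  fixes u e :: "'a::euclidean_space" and g :: "real \<Rightarrow> real \<Rightarrow> ennreal"
  assumes e: "e \<in> Basis" and [measurable]: "case_prod g \<in> borel_measurable (borel \<Otimes>\<^sub>M borel)"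
    and t: "t > 0"
  shows "(\<integral>\<^sup>+x. (\<Prod>b\<in>Basis. gauss t (x \<bullet> b)) * g (x \<bullet> e) (u \<bullet> x) \<partial>lborel) =
    (\<integral>\<^sup>+y. \<integral>\<^sup>+h. gauss t y * gauss t h *
       g y ((u \<bullet> e) * y + sqrt ((norm u)\<^sup>2 - (u \<bullet> e)\<^sup>2) * h) \<partial>lborel \<partial>lborel)"
proof -
  interpret product_sigma_finite "\<lambda>_::'a. lborel :: real measure" by standard
  define I where "I = (Basis :: 'a set) - {e}"
  have B: "(Basis :: 'a set) = insert e I" "finite I" "e \<notin> I"
    using e by (auto simp: I_def)
  have nrm: "(norm u)\<^sup>2 - (u \<bullet> e)\<^sup>2 = (\<Sum>b\<in>I. (u \<bullet> b)\<^sup>2)"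
  proof -
    have "(norm u)\<^sup>2 = (\<Sum>b\<in>Basis. (u \<bullet> b)\<^sup>2)"
      unfolding power2_norm_eq_inner euclidean_inner[of u u] by (simp only: power2_eq_square)
    also have "\<dots> = (u \<bullet> e)\<^sup>2 + (\<Sum>b\<in>I. (u \<bullet> b)\<^sup>2)"
      unfolding B(1) using B(2,3) by simp
    finally show ?thesis by simp
  qed
  have upd: "(\<Prod>b\<in>I. gauss t (if b = e then y else x b)) = (\<Prod>b\<in>I. gauss t (x b))"
      "(\<Sum>b\<in>I. (u \<bullet> b) * (if b = e then y else x b)) = (\<Sum>b\<in>I. (u \<bullet> b) * x b)" for x y
    by (intro prod.cong sum.cong; use B in auto)+
  have "(\<integral>\<^sup>+x. (\<Prod>b\<in>Basis. gauss t (x \<bullet> b)) * g (x \<bullet> e) (u \<bullet> x) \<partial>lborel)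
    = (\<integral>\<^sup>+f. (\<Prod>b\<in>Basis. gauss t (f b)) * g (f e) (\<Sum>b\<in>Basis. (u \<bullet> b) * f b)
         \<partial>Pi\<^sub>M Basis (\<lambda>_. lborel))"
    by (subst lborel_eq, subst nn_integral_distr)
       (auto simp: e inner_sum_right algebra_simps intro!: nn_integral_cong)
  also have "\<dots> = (\<integral>\<^sup>+f. (\<Prod>b\<in>insert e I. gauss t (f b)) * g (f e) (\<Sum>b\<in>insert e I. (u \<bullet> b) * f b)
         \<partial>Pi\<^sub>M (insert e I) (\<lambda>_. lborel))"
    by (simp only: B(1))
  \<comment> \<open>The coordinate along \<open>e\<close> becomes the outer variable, so that it is
    a constant while the others are merged.\<close>
  also have "\<dots> = (\<integral>\<^sup>+y. \<integral>\<^sup>+x. gauss t y * ((\<Prod>b\<in>I. gauss t (x b)) *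
         g y ((u \<bullet> e) * y + (\<Sum>b\<in>I. (u \<bullet> b) * x b))) \<partial>Pi\<^sub>M I (\<lambda>_. lborel) \<partial>lborel)"
    by (subst product_nn_integral_insert_rev) (use B(2,3) in \<open>simp_all add: upd mult.assoc\<close>)
  also have "\<dots> = (\<integral>\<^sup>+y. gauss t y * (\<integral>\<^sup>+x. (\<Prod>b\<in>I. gauss t (x b)) *
         g y ((u \<bullet> e) * y + (\<Sum>b\<in>I. (u \<bullet> b) * x b)) \<partial>Pi\<^sub>M I (\<lambda>_. lborel)) \<partial>lborel)"
    by (intro nn_integral_cong nn_integral_cmult) measurable
  also have "\<dots> = (\<integral>\<^sup>+y. gauss t y * (\<integral>\<^sup>+h. gauss t h *
         g y ((u \<bullet> e) * y + sqrt (\<Sum>b\<in>I. (u \<bullet> b)\<^sup>2) * h) \<partial>lborel) \<partial>lborel)"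
    by (subst nn_integral_gauss_sum_PiM[where g = "\<lambda>z. g y ((u \<bullet> e) * y + z)" for y])
       (use B t in auto)
  also have "\<dots> = (\<integral>\<^sup>+y. \<integral>\<^sup>+h. gauss t y * gauss t h *
         g y ((u \<bullet> e) * y + sqrt (\<Sum>b\<in>I. (u \<bullet> b)\<^sup>2) * h) \<partial>lborel \<partial>lborel)"
    by (subst nn_integral_cmult[symmetric]) (auto intro!: nn_integral_cong simp: mult_ac)
  finally show ?thesis by (simp only: nrm)
qed

section \<open>The skew-Cauchy density as a Gamma mixture of Gaussians\<close>

text \<open>Euler's integral for \<open>Gamma p\<close> after the substitution \<open>s * t\<close>.
  Read from right to left, it turns a negative power into a mixture of exponentials.\<close>

lemma nn_integral_Gamma_scaled:
  fixes p s :: real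
  assumes "p > 0" "s > 0"
  shows "(\<integral>\<^sup>+t. ennreal (indicator {0<..} t * t powr (p - 1) * exp (- (t * s))) \<partial>lborel)
       = ennreal (Gamma p * s powr (- p))"
proof -
  have "ennreal (Gamma p) = (\<integral>\<^sup>+t. ennreal (indicator {0..} t * t powr (p - 1) / exp t) \<partial>lborel)"
    by (rule Gamma_conv_nn_integral_real) fact
  also have "\<dots> = ennreal s * (\<integral>\<^sup>+t. ennreal (indicator {0..} (s * t) * (s * t) powr (p - 1) / exp (s * t)) \<partial>lborel)"
    by (subst nn_integral_real_affine[where t=0 and c=s]) (use assms in auto)
  also have "\<dots> = (\<integral>\<^sup>+t. ennreal (s powr p) *
                 ennreal (indicator {0<..} t * t powr (p - 1) * exp (- (t * s))) \<partial>lborel)"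
  proof (subst nn_integral_cmult[symmetric], simp, rule nn_integral_cong)
    fix t :: real
    have "s * (indicator {0..} (s * t) * (s * t) powr (p - 1) / exp (s * t))
        = s powr p * (indicator {0<..} t * t powr (p - 1) * exp (- (t * s)))"
    proof (cases "t > 0")
      case True
      have "s * s powr (p - 1) = s powr p"
        using assms by (simp add: powr_diff)
      then show ?thesis
        using True assms by (simp add: powr_mult exp_minus divide_inverse mult_ac)
    next
      \<comment> \<open>At \<open>t = 0\<close> the closed and the open indicator differ, but
        \<open>0 powr (p - 1)\<close> is 0, so both sides vanish.\<close>
      case False
      then show ?thesis
        using assms by (cases "t = 0") (auto simp: indicator_def zero_le_mult_iff)
    qed
    then show "ennreal s * ennreal (indicator {0..} (s * t) * (s * t) powr (p - 1) / exp (s * t))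
        = ennreal (s powr p) * ennreal (indicator {0<..} t * t powr (p - 1) * exp (- (t * s)))"
      using assms by (simp flip: ennreal_mult')
  qed
  also have "\<dots> = ennreal (s powr p) *
      (\<integral>\<^sup>+t. ennreal (indicator {0<..} t * t powr (p - 1) * exp (- (t * s))) \<partial>lborel)"
    by (rule nn_integral_cmult) measurable
  finally have *: "ennreal (Gamma p) = ennreal (s powr p) *
      (\<integral>\<^sup>+t. ennreal (indicator {0<..} t * t powr (p - 1) * exp (- (t * s))) \<partial>lborel)" .
  have "ennreal (Gamma p * s powr (- p)) = ennreal (s powr (- p)) * ennreal (Gamma p)"
    using assms by (simp add: mult.commute flip: ennreal_mult')
  also have "\<dots> = ennreal (s powr (- p) * s powr p) *
      (\<integral>\<^sup>+t. ennreal (indicator {0<..} t * t powr (p - 1) * exp (- (t * s))) \<partial>lborel)"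
    by (subst *) (simp add: mult.assoc ennreal_mult')
  also have "s powr (- p) * s powr p = 1"
    using assms by (simp flip: powr_add)
  finally show ?thesis by simp
qed

text \<open>Writing the power as a mixture over \<open>t\<close> makes the integrand Gaussian in
  \<open>w\<close>; after exchanging the integrals the Gaussian has mass 1 and another Gamma
  integral remains. This provides the finiteness of the Student measure.\<close>

lemma nn_integral_student_kernel:
  assumes "m > 0"
  shows "(\<integral>\<^sup>+w. ennreal (Gamma ((m + 1) / 2) * (1 + w\<^sup>2) powr (- ((m + 1) / 2))) \<partial>lborel)
       = ennreal (sqrt pi * Gamma (m / 2))"
proof -
  have "(\<integral>\<^sup>+w. ennreal (Gamma ((m + 1) / 2) * (1 + w\<^sup>2) powr (- ((m + 1) / 2))) \<partial>lborel)
    = (\<integral>\<^sup>+w. \<integral>\<^sup>+t. ennreal (indicator {0<..} t * t powr ((m + 1) / 2 - 1) * exp (- (t * (1 + w\<^sup>2))))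
         \<partial>lborel \<partial>lborel)"
    using assms by (subst nn_integral_Gamma_scaled) (auto intro: add_pos_nonneg)
  also have "\<dots> = (\<integral>\<^sup>+w. \<integral>\<^sup>+t. ennreal (indicator {0<..} t * (sqrt pi * t powr (m / 2 - 1)) * exp (- t)) * gauss t w
         \<partial>lborel \<partial>lborel)"
  proof (intro nn_integral_cong)
    fix w t :: real
    show "ennreal (indicator {0<..} t * t powr ((m + 1) / 2 - 1) * exp (- (t * (1 + w\<^sup>2))))
      = ennreal (indicator {0<..} t * (sqrt pi * t powr (m / 2 - 1)) * exp (- t)) * gauss t w"
    proof (cases "t > 0")
      case True
      have "t powr ((m + 1) / 2 - 1) = t powr (m / 2 - 1) * sqrt t"
        using True by (simp add: powr_half_sqrt[symmetric] add_divide_distrib flip: powr_add)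
      then show ?thesis
        using True by (simp add: gauss_def ennreal_mult'[symmetric] real_sqrt_divide algebra_simps flip: exp_add)
    qed simp
  qed
  also have "\<dots> = (\<integral>\<^sup>+t. \<integral>\<^sup>+w. ennreal (indicator {0<..} t * (sqrt pi * t powr (m / 2 - 1)) * exp (- t)) * gauss t w
         \<partial>lborel \<partial>lborel)"
    by (rule lborel_pair.Fubini') measurable
  also have "\<dots> = (\<integral>\<^sup>+t. ennreal (sqrt pi) * ennreal (indicator {0<..} t * t powr (m / 2 - 1) * exp (- (t * 1))) \<partial>lborel)"
  proof (rule nn_integral_cong)
    fix t :: real
    show "(\<integral>\<^sup>+w. ennreal (indicator {0<..} t * (sqrt pi * t powr (m / 2 - 1)) * exp (- t)) * gauss t w \<partial>lborel)
      = ennreal (sqrt pi) * ennreal (indicator {0<..} t * t powr (m / 2 - 1) * exp (- (t * 1)))"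
      by (subst nn_integral_cmult, simp, cases "t > 0")
         (auto simp: nn_integral_gauss mult_ac simp flip: ennreal_mult')
  qed
  also have "\<dots> = ennreal (sqrt pi) * ennreal (Gamma (m / 2) * 1 powr (- (m / 2)))"
    using assms by (subst nn_integral_cmult, simp, subst nn_integral_Gamma_scaled) auto
  finally show ?thesis by (simp add: ennreal_mult')
qed

text \<open>The substitution \<open>x = sqrt (m / S) * w\<close> removes the scaling from the
  argument of the Student distribution function: the threshold becomes \<open>b\<close>, and the
  density becomes the conditional density of the extra Cauchy coordinate \<open>w\<close> when
  \<open>S\<close> is 1 plus the squared norm of the others.\<close>

lemma ennreal_student_t_cdf:
  fixes m S b :: real
  assumes m: "m > 0" and S: "S > 0"
  shows "ennreal (student_t_cdf m (b * sqrt (m / S))) =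
    (\<integral>\<^sup>+w. (if w \<le> b then 1 else 0) * ennreal (Gamma ((m + 1) / 2) / (sqrt pi * Gamma (m / 2)) *
        S powr (m / 2) * (S + w\<^sup>2) powr (- ((m + 1) / 2))) \<partial>lborel)"
proof -
  define C where "C = 1 / (sqrt pi * Gamma (m / 2))"
  define D where "D = density lborel (\<lambda>x. ennreal (student_t_density m x))"
  have C: "C > 0" and G: "Gamma ((m + 1) / 2) > 0"
    using m by (auto simp: C_def)
  have [measurable]: "student_t_density m \<in> borel_measurable borel"
    unfolding student_t_density_def[abs_def] by measurable
  have kern: "student_t_density m (sqrt (m / S) * w) * sqrt (m / S)
      = Gamma ((m + 1) / 2) * C * S powr (m / 2) * (S + w\<^sup>2) powr (- ((m + 1) / 2))"
    if S: "S > 0" for w S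
  proof -
    have Sw: "S + w\<^sup>2 > 0" using S by (simp add: add_pos_nonneg)
    have "1 + (sqrt (m / S) * w)\<^sup>2 / m = (S + w\<^sup>2) / S"
      using m S by (simp add: power_mult_distrib field_simps)
    then have "(1 + (sqrt (m / S) * w)\<^sup>2 / m) powr (- ((m + 1) / 2))
        = ((S + w\<^sup>2) / S) powr (- ((m + 1) / 2))"
      by (simp only:)
    also have "\<dots> = (S + w\<^sup>2) powr (- ((m + 1) / 2)) * S powr ((m + 1) / 2)"
      using Sw S by (simp add: powr_divide powr_minus divide_simps)
    finally have "(1 + (sqrt (m / S) * w)\<^sup>2 / m) powr (- ((m + 1) / 2))
        = (S + w\<^sup>2) powr (- ((m + 1) / 2)) * S powr ((m + 1) / 2)" .
    moreover have "S powr ((m + 1) / 2) = S powr (m / 2) * sqrt S"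
      using S by (simp add: powr_half_sqrt[symmetric] add_divide_distrib flip: powr_add)
    ultimately show ?thesis
      using m S by (simp add: student_t_density_def C_def real_sqrt_mult real_sqrt_divide)
  qed
  \<comment> \<open>\<open>cdf\<close> is built on the real-valued \<open>measure\<close>, which
    sends infinite mass to 0, so \<open>D\<close> has to be shown finite before passing to
    \<open>emeasure\<close>. \<open>kern\<close> at \<open>S = 1\<close> reduces this to the kernel
    integral.\<close>
  have "emeasure D UNIV = (\<integral>\<^sup>+x. ennreal (student_t_density m x) \<partial>lborel)"
    by (simp add: D_def emeasure_density)
  also have "\<dots> = (\<integral>\<^sup>+w. ennreal (sqrt (m / 1)) * ennreal (student_t_density m (sqrt (m / 1) * w)) \<partial>lborel)"
    by (subst nn_integral_real_affine[where t=0 and c="sqrt (m / 1)"]) (use m in \<open>auto simp: nn_integral_cmult\<close>)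
  also have "\<dots> = (\<integral>\<^sup>+w. ennreal C * ennreal (Gamma ((m + 1) / 2) * (1 + w\<^sup>2) powr (- ((m + 1) / 2))) \<partial>lborel)"
    using kern[of 1] m C by (intro nn_integral_cong) (simp add: mult_ac flip: ennreal_mult')
  also have "\<dots> = ennreal C * ennreal (sqrt pi * Gamma (m / 2))"
    using m by (subst nn_integral_cmult) (auto simp: nn_integral_student_kernel)
  also have "\<dots> < \<infinity>"
    by (simp add: ennreal_mult_less_top)
  finally have "emeasure D UNIV < \<infinity>" .
  then interpret D: finite_measure D
    by (intro finite_measureI) (simp add: D_def less_top)
  have "ennreal (student_t_cdf m (b * sqrt (m / S))) = emeasure D {..b * sqrt (m / S)}"
    by (simp add: student_t_cdf_def cdf_def D_def[symmetric] D.emeasure_eq_measure)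
  also have "\<dots> = (\<integral>\<^sup>+x. ennreal (student_t_density m x) * indicator {..b * sqrt (m / S)} x \<partial>lborel)"
    by (simp add: D_def emeasure_density)
  also have "\<dots> = (\<integral>\<^sup>+w. ennreal (sqrt (m / S)) * (ennreal (student_t_density m (sqrt (m / S) * w)) *
        indicator {..b * sqrt (m / S)} (sqrt (m / S) * w)) \<partial>lborel)"
    by (subst nn_integral_real_affine[where t=0 and c="sqrt (m / S)"]) (use m S in \<open>auto simp: nn_integral_cmult\<close>)
  also have "\<dots> = (\<integral>\<^sup>+w. (if w \<le> b then 1 else 0) * ennreal (Gamma ((m + 1) / 2) * C *
        S powr (m / 2) * (S + w\<^sup>2) powr (- ((m + 1) / 2))) \<partial>lborel)"
  proof (rule nn_integral_cong)
    fix w :: real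
    have "sqrt (m / S) * w \<le> b * sqrt (m / S) \<longleftrightarrow> w \<le> b"
      using m S by (simp add: mult.commute[of b])
    then show "ennreal (sqrt (m / S)) * (ennreal (student_t_density m (sqrt (m / S) * w)) *
        indicator {..b * sqrt (m / S)} (sqrt (m / S) * w)) =
       (if w \<le> b then 1 else 0) * ennreal (Gamma ((m + 1) / 2) * C *
        S powr (m / 2) * (S + w\<^sup>2) powr (- ((m + 1) / 2)))"
      using m S kern[OF S, of w] by (auto simp: mult.commute indicator_def simp flip: ennreal_mult')
  qed
  finally show ?thesis by (simp add: C_def)
qed

text \<open>The radial factor times the conditional density of \<open>w\<close> is, up to a
  constant, the spherical Cauchy density in \<open>d + 1\<close> dimensions, a negative power of
  \<open>S + w^2\<close>. As a mixture it is a product of \<open>d + 1\<close> Gaussian densities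
  averaged over \<open>t\<close>; the weight is twice the Gamma density of shape 1/2, the 2 coming
  from the skewed density.\<close>

lemma csc_density_gauss_mixture:
  fixes x :: "real ^ 'n::finite"
  shows "ennreal (csc_density k \<gamma> x) =
    (\<integral>\<^sup>+w. (if w \<le> \<gamma> * (x $ k) then 1 else 0) *
       (\<integral>\<^sup>+t. ennreal (indicator {0<..} t * (2 / sqrt pi * t powr (- (1 / 2))) * exp (- t)) *
          ((\<Prod>b\<in>Basis. gauss t (x \<bullet> b)) * gauss t w) \<partial>lborel) \<partial>lborel)"
proof -
  define d where "d = real CARD('n)"
  define S where "S = 1 + (norm x)\<^sup>2"
  have d: "d > 0" by (simp add: d_def)
  have S: "S > 0" by (simp add: S_def add_pos_nonneg)
  define A where "A = 2 * (Gamma ((1 + d) / 2) / (pi powr (d / 2) * sqrt pi)) * S powr (- ((1 + d) / 2))"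
  have A: "A > 0" using d S by (simp add: A_def)
  have nrm: "(norm x)\<^sup>2 = (\<Sum>b\<in>Basis. (x \<bullet> b)\<^sup>2)"
    unfolding power2_norm_eq_inner euclidean_inner[of x x] by (simp only: power2_eq_square)
  have pis: "pi powr ((2 + d) / 2) = pi powr (d / 2) * pi"
    by (simp add: add_divide_distrib powr_add)
  have pw: "S powr (- ((1 + d) / 2)) * S powr ((1 + d) / 2) = 1"
    using S by (simp flip: powr_add)
  have mix: "ennreal (Gamma ((2 + d) / 2) * (S + w\<^sup>2) powr (- ((2 + d) / 2)) * (2 / pi powr ((2 + d) / 2)))
     = (\<integral>\<^sup>+t. ennreal (indicator {0<..} t * (2 / sqrt pi * t powr (- (1 / 2))) * exp (- t)) *
          ((\<Prod>b\<in>Basis. gauss t (x \<bullet> b)) * gauss t w) \<partial>lborel)" for w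
  proof -
    have Sw: "S + w\<^sup>2 > 0" using S by (simp add: add_pos_nonneg)
    have "ennreal (Gamma ((2 + d) / 2) * (S + w\<^sup>2) powr (- ((2 + d) / 2)) * (2 / pi powr ((2 + d) / 2)))
      = (\<integral>\<^sup>+t. ennreal (indicator {0<..} t * t powr ((2 + d) / 2 - 1) * exp (- (t * (S + w\<^sup>2)))) *
           ennreal (2 / pi powr ((2 + d) / 2)) \<partial>lborel)"
      using d Sw by (subst nn_integral_multc, simp, subst nn_integral_Gamma_scaled) (auto simp flip: ennreal_mult'')
    also have "\<dots> = (\<integral>\<^sup>+t. ennreal (indicator {0<..} t * (2 / sqrt pi * t powr (- (1 / 2))) * exp (- t)) *
          ((\<Prod>b\<in>Basis. gauss t (x \<bullet> b)) * gauss t w) \<partial>lborel)"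
    proof (rule nn_integral_cong)
      fix t :: real
      show "ennreal (indicator {0<..} t * t powr ((2 + d) / 2 - 1) * exp (- (t * (S + w\<^sup>2)))) *
           ennreal (2 / pi powr ((2 + d) / 2)) =
         ennreal (indicator {0<..} t * (2 / sqrt pi * t powr (- (1 / 2))) * exp (- t)) *
          ((\<Prod>b\<in>Basis. gauss t (x \<bullet> b)) * gauss t w)"
      proof (cases "t > 0")
        case True
        have "(\<Prod>b\<in>Basis. gauss t (x \<bullet> b)) =
            ennreal (sqrt (t / pi) ^ CARD('n) * exp (- (t * (norm x)\<^sup>2)))"
          using True by (simp add: gauss_def prod_ennreal prod.distrib nrm sum_negf sum_distrib_left flip: exp_sum)
        also have "sqrt (t / pi) ^ CARD('n) = t powr (d / 2) / pi powr (d / 2)"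
          using True by (simp add: d_def powr_half_sqrt[symmetric] powr_realpow[symmetric] powr_powr powr_divide)
        finally have 1: "(\<Prod>b\<in>Basis. gauss t (x \<bullet> b)) =
            ennreal (t powr (d / 2) / pi powr (d / 2) * exp (- (t * (norm x)\<^sup>2)))" .
        have 2: "t powr ((2 + d) / 2 - 1) = t powr (d / 2)"
          by (simp add: add_divide_distrib)
        \<comment> \<open>The \<open>d + 1\<close> Gaussian normalisations contribute the power
          \<open>(d + 1) / 2\<close> of \<open>t\<close>. The weight takes away one square root,
          which leaves the exponent \<open>d / 2\<close> required by the Gamma integral.\<close>
        have 3: "t powr (- (1 / 2)) * sqrt t = 1"
          using True by (simp add: powr_half_sqrt[symmetric] flip: powr_add)
        have 4: "exp (- (t * (S + w\<^sup>2))) = exp (- t) * exp (- (t * (norm x)\<^sup>2)) * exp (- (t * w\<^sup>2))"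
          by (simp add: S_def algebra_simps flip: exp_add)
        have "t powr (d / 2) * exp (- (t * (S + w\<^sup>2))) * (2 / (pi powr (d / 2) * pi))
          = (t powr (- (1 / 2)) * sqrt t) * t powr (d / 2) * exp (- (t * (S + w\<^sup>2))) * (2 / (pi powr (d / 2) * (sqrt pi * sqrt pi)))"
          by (simp only: 3) simp
        also have "\<dots> = (2 / sqrt pi * t powr (- (1 / 2))) * exp (- t) *
           (t powr (d / 2) / pi powr (d / 2) * exp (- (t * (norm x)\<^sup>2)) * (sqrt (t / pi) * exp (- (t * w\<^sup>2))))"
          unfolding 4 real_sqrt_divide by (simp add: mult_ac)
        finally show ?thesis
          using True unfolding 1 unfolding 2 pis gauss_def by (simp flip: ennreal_mult')
      qed simp
    qed
    finally show ?thesis .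
  qed
  \<comment> \<open>The Student normalisation and its power of \<open>S\<close> cancel against
    \<open>Gamma ((1 + d) / 2)\<close> and the power of \<open>S\<close> in the radial factor
    \<open>A\<close>.\<close>
  have const: "A * (Gamma ((d + 1 + 1) / 2) / (sqrt pi * Gamma ((d + 1) / 2)) * S powr ((d + 1) / 2) *
        (S + w\<^sup>2) powr (- ((d + 1 + 1) / 2)))
      = Gamma ((2 + d) / 2) * (S + w\<^sup>2) powr (- ((2 + d) / 2)) * (2 / pi powr ((2 + d) / 2))" for w
  proof -
    have "Gamma ((1 + d) / 2) \<noteq> 0" using d by (simp add: Gamma_eq_zero_iff nonpos_Ints_def)
    then have "A * (Gamma ((d + 1 + 1) / 2) / (sqrt pi * Gamma ((d + 1) / 2)) * S powr ((d + 1) / 2) *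
        (S + w\<^sup>2) powr (- ((d + 1 + 1) / 2)))
      = (S powr (- ((1 + d) / 2)) * S powr ((1 + d) / 2)) * (2 / (pi powr (d / 2) * (sqrt pi * sqrt pi))) *
         Gamma ((2 + d) / 2) * (S + w\<^sup>2) powr (- ((2 + d) / 2))"
      by (simp add: A_def add_ac)
    also have "\<dots> = Gamma ((2 + d) / 2) * (S + w\<^sup>2) powr (- ((2 + d) / 2)) * (2 / pi powr ((2 + d) / 2))"
      unfolding pw pis by simp
    finally show ?thesis .
  qed
  have "csc_density k \<gamma> x = A * student_t_cdf (d + 1) (\<gamma> * x $ k * sqrt ((d + 1) / S))"
    by (simp add: csc_density_def Let_def d_def A_def S_def Gamma_one_half_real add_ac)
  then have "ennreal (csc_density k \<gamma> x) = ennreal A * ennreal (student_t_cdf (d + 1) (\<gamma> * x $ k * sqrt ((d + 1) / S)))"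
    using A by (simp add: ennreal_mult')
  also have "\<dots> = (\<integral>\<^sup>+w. (if w \<le> \<gamma> * (x $ k) then 1 else 0) *
       ennreal (A * (Gamma ((d + 1 + 1) / 2) / (sqrt pi * Gamma ((d + 1) / 2)) * S powr ((d + 1) / 2) *
        (S + w\<^sup>2) powr (- ((d + 1 + 1) / 2)))) \<partial>lborel)"
    using d S A by (subst ennreal_student_t_cdf, simp, simp, subst nn_integral_cmult[symmetric])
      (auto intro!: nn_integral_cong simp flip: ennreal_mult')
  finally show ?thesis unfolding const mix .
qed

section \<open>Half-space probabilities as planar integrals\<close>

text \<open>For fixed \<open>t\<close> everything is Gaussian: \<open>x\<close> reduces to its
  coordinate \<open>y\<close> along \<open>k\<close> and one orthogonal variable \<open>h\<close>. A
  rotation of \<open>(y, w)\<close> turns the skewing event into \<open>0 \<le> a\<close>, and the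
  second rotated variable merges with \<open>h\<close>. Integrating \<open>t\<close> out last gives
  a planar Cauchy kernel.\<close>

lemma nn_integral_csc_halfspace:
  fixes u :: "real ^ 'n::finite" and k :: 'n
  assumes u: "norm u = 1"
    and [measurable]: "(\<lambda>x. ennreal (csc_density k \<gamma> x)) \<in> borel_measurable lborel"
  defines "\<rho> \<equiv> \<gamma> / sqrt (1 + \<gamma>\<^sup>2) * u $ k"
  shows "(\<integral>\<^sup>+x. ennreal (csc_density k \<gamma> x) * indicator {x. u \<bullet> x \<le> c} x \<partial>lborel) =
    (\<integral>\<^sup>+a. \<integral>\<^sup>+h. (if 0 \<le> a \<and> \<rho> * a + sqrt (1 - \<rho>\<^sup>2) * h \<le> c then 1 else 0) *
      ennreal ((1 + a\<^sup>2 + h\<^sup>2) powr (- (3 / 2)) / pi) \<partial>lborel \<partial>lborel)"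
proof -
  define r where "r = sqrt (1 + \<gamma>\<^sup>2)"
  have r: "r > 0" and r2: "r\<^sup>2 = 1 + \<gamma>\<^sup>2" by (auto simp: r_def add_pos_nonneg)
  define W where "W t = ennreal (indicator {0<..} t * (2 / sqrt pi * t powr (- (1 / 2))) * exp (- t))" for t
  have [measurable]: "W \<in> borel_measurable borel" unfolding W_def[abs_def] by measurable
  define \<tau> where "\<tau> = sqrt ((norm u)\<^sup>2 - (u $ k)\<^sup>2)"
  have "\<bar>u $ k\<bar> \<le> 1" using component_le_norm_cart[of u k] u by simp
  then have \<tau>2: "\<tau>\<^sup>2 = 1 - (u $ k)\<^sup>2" by (simp add: \<tau>_def u abs_square_le_1)
  let ?L = "\<lambda>P. (if P then 1 else 0 :: ennreal)"
  let ?K = "\<lambda>t a h. gauss t a * gauss t h * ?L (0 \<le> a \<and> \<rho> * a + sqrt (1 - \<rho>\<^sup>2) * h \<le> c)"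
  have planar: "(\<integral>\<^sup>+x. (\<Prod>b\<in>Basis. gauss t (x \<bullet> b)) *
      ((\<integral>\<^sup>+w. gauss t w * ?L (w \<le> \<gamma> * (x \<bullet> axis k 1)) \<partial>lborel) * ?L (u \<bullet> x \<le> c)) \<partial>lborel)
    = (\<integral>\<^sup>+a. \<integral>\<^sup>+h. ?K t a h \<partial>lborel \<partial>lborel)" if t: "t > 0" for t
  proof -
    have "(\<integral>\<^sup>+x. (\<Prod>b\<in>Basis. gauss t (x \<bullet> b)) *
        ((\<integral>\<^sup>+w. gauss t w * ?L (w \<le> \<gamma> * (x \<bullet> axis k 1)) \<partial>lborel) * ?L (u \<bullet> x \<le> c)) \<partial>lborel)
      = (\<integral>\<^sup>+y. \<integral>\<^sup>+h. gauss t y * gauss t h *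
          ((\<integral>\<^sup>+w. gauss t w * ?L (w \<le> \<gamma> * y) \<partial>lborel) * ?L (u $ k * y + \<tau> * h \<le> c)) \<partial>lborel \<partial>lborel)"
      by (subst nn_integral_gauss_reduce[where g = "\<lambda>y z. (\<integral>\<^sup>+w. gauss t w * ?L (w \<le> \<gamma> * y) \<partial>lborel) * ?L (z \<le> c)"])
         (use t in \<open>simp_all add: \<tau>_def inner_axis axis_in_Basis_iff\<close>)
    \<comment> \<open>\<open>h\<close> is moved outside so that \<open>y\<close> and
      \<open>w\<close> become the two inner variables, ready to be rotated.\<close>
    also have "\<dots> = (\<integral>\<^sup>+h. \<integral>\<^sup>+y. gauss t y * gauss t h *
          ((\<integral>\<^sup>+w. gauss t w * ?L (w \<le> \<gamma> * y) \<partial>lborel) * ?L (u $ k * y + \<tau> * h \<le> c)) \<partial>lborel \<partial>lborel)"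
      by (rule lborel_pair.Fubini'[symmetric]) measurable
    also have "\<dots> = (\<integral>\<^sup>+h. \<integral>\<^sup>+y. \<integral>\<^sup>+w. gauss t y * gauss t w *
          (gauss t h * (?L (w \<le> \<gamma> * y) * ?L (u $ k * y + \<tau> * h \<le> c))) \<partial>lborel \<partial>lborel \<partial>lborel)"
    proof (intro nn_integral_cong)
      fix h y :: real
      have "gauss t y * gauss t h * ((\<integral>\<^sup>+w. gauss t w * ?L (w \<le> \<gamma> * y) \<partial>lborel) * ?L (u $ k * y + \<tau> * h \<le> c))
        = (gauss t y * gauss t h * ?L (u $ k * y + \<tau> * h \<le> c)) * (\<integral>\<^sup>+w. gauss t w * ?L (w \<le> \<gamma> * y) \<partial>lborel)"
        by (simp only: mult_ac)
      also have "\<dots> = (\<integral>\<^sup>+w. gauss t y * gauss t w *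
          (gauss t h * (?L (w \<le> \<gamma> * y) * ?L (u $ k * y + \<tau> * h \<le> c))) \<partial>lborel)"
        by (subst nn_integral_cmult[symmetric]) (simp_all only: mult_ac, measurable)
      finally show "gauss t y * gauss t h * ((\<integral>\<^sup>+w. gauss t w * ?L (w \<le> \<gamma> * y) \<partial>lborel) * ?L (u $ k * y + \<tau> * h \<le> c))
        = \<dots>" .
    qed
    also have "\<dots> = (\<integral>\<^sup>+h. \<integral>\<^sup>+a. \<integral>\<^sup>+b. gauss t a * gauss t b *
          (gauss t h * (?L (0 \<le> a) * ?L (\<rho> * a + (u $ k / r * b + \<tau> * h) \<le> c))) \<partial>lborel \<partial>lborel \<partial>lborel)"
    proof (rule nn_integral_cong)
      fix h :: real
      \<comment> \<open>The rotation with cosine \<open>\<gamma> / r\<close> and sine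
        \<open>- (1 / r)\<close> maps the axis \<open>a = 0\<close> to the line
        \<open>w = \<gamma> * y\<close>; the sign of the sine makes the event the side
        \<open>a \<ge> 0\<close>.\<close>
      have cs: "(\<gamma> / r)\<^sup>2 + (- (1 / r))\<^sup>2 = 1"
        using r by (simp add: power_divide r2 add_divide_distrib[symmetric] add.commute)
           (metis r2 divide_self less_irrefl power_not_zero add.commute)
      have "- (1 / r) * a + \<gamma> / r * b \<le> \<gamma> * (\<gamma> / r * a - - (1 / r) * b) \<longleftrightarrow> 0 \<le> a" for a b
      proof -
        have "\<gamma> * (\<gamma> / r * a - - (1 / r) * b) - (- (1 / r) * a + \<gamma> / r * b) = (1 + \<gamma>\<^sup>2) * (a / r)"
          by (simp add: algebra_simps power2_eq_square add_divide_distrib)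
        also have "\<dots> = r * a" unfolding r2[symmetric] using r by (simp add: power2_eq_square)
        finally show ?thesis using r by (smt (verit) zero_le_mult_iff)
      qed
      moreover have "u $ k * (\<gamma> / r * a - - (1 / r) * b) + \<tau> * h = \<rho> * a + (u $ k / r * b + \<tau> * h)" for a b
        by (simp add: \<rho>_def r_def[symmetric] algebra_simps)
      ultimately show "(\<integral>\<^sup>+y. \<integral>\<^sup>+w. gauss t y * gauss t w *
          (gauss t h * (?L (w \<le> \<gamma> * y) * ?L (u $ k * y + \<tau> * h \<le> c))) \<partial>lborel \<partial>lborel)
         = (\<integral>\<^sup>+a. \<integral>\<^sup>+b. gauss t a * gauss t b *
          (gauss t h * (?L (0 \<le> a) * ?L (\<rho> * a + (u $ k / r * b + \<tau> * h) \<le> c))) \<partial>lborel \<partial>lborel)"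
        using t by (subst nn_integral_gauss_rotation[OF _ cs]) (measurable, simp_all only: less_imp_le)
    qed
    also have "\<dots> = (\<integral>\<^sup>+a. \<integral>\<^sup>+h. \<integral>\<^sup>+b. gauss t a * gauss t b *
          (gauss t h * (?L (0 \<le> a) * ?L (\<rho> * a + (u $ k / r * b + \<tau> * h) \<le> c))) \<partial>lborel \<partial>lborel \<partial>lborel)"
      by (rule lborel_pair.Fubini') measurable
    also have "\<dots> = (\<integral>\<^sup>+a. (gauss t a * ?L (0 \<le> a)) * (\<integral>\<^sup>+h. \<integral>\<^sup>+b. gauss t h * gauss t b *
          ?L (\<rho> * a + (\<tau> * h + u $ k / r * b) \<le> c) \<partial>lborel \<partial>lborel) \<partial>lborel)"
      by (rule nn_integral_cong, subst nn_integral_cmult[symmetric], measurable,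
          rule nn_integral_cong, subst nn_integral_cmult[symmetric], measurable,
          rule nn_integral_cong) (simp only: mult_ac add_ac)
    also have "\<dots> = (\<integral>\<^sup>+a. (gauss t a * ?L (0 \<le> a)) * (\<integral>\<^sup>+h. gauss t h *
          ?L (\<rho> * a + sqrt (\<tau>\<^sup>2 + (u $ k / r)\<^sup>2) * h \<le> c) \<partial>lborel) \<partial>lborel)"
      using t by (subst nn_integral_gauss_merge[where g = "\<lambda>z. ?L (\<rho> * a + z \<le> c)" for a]) simp_all
    \<comment> \<open>The squared coefficient of the merged variable is \<open>1 - (u $ k)^2\<close>
      from the coordinates other than \<open>k\<close> plus
      \<open>(u $ k)^2 / (1 + \<gamma>^2)\<close> from \<open>b\<close>.\<close>
    also have "\<tau>\<^sup>2 + (u $ k / r)\<^sup>2 = 1 - \<rho>\<^sup>2"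
    proof -
      have "(u $ k / r)\<^sup>2 + \<rho>\<^sup>2 = (1 + \<gamma>\<^sup>2) * (u $ k)\<^sup>2 / r\<^sup>2"
        by (simp add: \<rho>_def r_def[symmetric] power_divide power_mult_distrib algebra_simps add_divide_distrib)
      then show ?thesis using r by (simp add: \<tau>2 r2[symmetric])
    qed
    also have "(\<integral>\<^sup>+a. (gauss t a * ?L (0 \<le> a)) * (\<integral>\<^sup>+h. gauss t h *
          ?L (\<rho> * a + sqrt (1 - \<rho>\<^sup>2) * h \<le> c) \<partial>lborel) \<partial>lborel) = (\<integral>\<^sup>+a. \<integral>\<^sup>+h. ?K t a h \<partial>lborel \<partial>lborel)"
      by (rule nn_integral_cong, subst nn_integral_cmult[symmetric], measurable,
          rule nn_integral_cong) auto
    finally show ?thesis .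
  qed
  \<comment> \<open>Two Gaussian normalisations and the weight leave the power 1/2 of
    \<open>t\<close>, so the mixture integral is \<open>Gamma (3 / 2)\<close>, half of
    \<open>sqrt pi\<close>; the result is twice the planar Cauchy density.\<close>
  have kern: "(\<integral>\<^sup>+t. W t * (gauss t a * gauss t h) \<partial>lborel) = ennreal ((1 + a\<^sup>2 + h\<^sup>2) powr (- (3 / 2)) / pi)" for a h
  proof -
    have "(1 / 2 :: real) \<notin> \<int>\<^sub>\<le>\<^sub>0"
      by (auto dest: nonpos_Ints_nonpos)
    then have G: "Gamma (3 / 2 :: real) = sqrt pi / 2"
      using Gamma_plus1[of "1 / 2 :: real"] by (simp add: Gamma_one_half_real)
    have "(\<integral>\<^sup>+t. W t * (gauss t a * gauss t h) \<partial>lborel) = (\<integral>\<^sup>+t. ennreal (2 / (sqrt pi * pi)) *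
       ennreal (indicator {0<..} t * t powr (3 / 2 - 1) * exp (- (t * (1 + a\<^sup>2 + h\<^sup>2)))) \<partial>lborel)"
    proof (rule nn_integral_cong)
      fix t :: real
      show "W t * (gauss t a * gauss t h) = ennreal (2 / (sqrt pi * pi)) *
         ennreal (indicator {0<..} t * t powr (3 / 2 - 1) * exp (- (t * (1 + a\<^sup>2 + h\<^sup>2))))"
      proof (cases "t > 0")
        case True
        have "t powr (- (1 / 2)) * t = t powr (3 / 2 - 1)"
          using True powr_mult_base[of t "- (1 / 2)"] by (simp add: mult.commute)
        moreover have "exp (- t) * exp (- (t * (a\<^sup>2 + h\<^sup>2))) = exp (- (t * (1 + a\<^sup>2 + h\<^sup>2)))"
          by (simp add: algebra_simps flip: exp_add)
        moreover have "2 / sqrt pi * t powr (- (1 / 2)) * exp (- t) * (t / pi * exp (- (t * (a\<^sup>2 + h\<^sup>2))))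
          = 2 / (sqrt pi * pi) * ((t powr (- (1 / 2)) * t) * (exp (- t) * exp (- (t * (a\<^sup>2 + h\<^sup>2)))))"
          by (simp add: mult_ac)
        ultimately have "2 / sqrt pi * t powr (- (1 / 2)) * exp (- t) * (t / pi * exp (- (t * (a\<^sup>2 + h\<^sup>2))))
          = 2 / (sqrt pi * pi) * (t powr (3 / 2 - 1) * exp (- (t * (1 + a\<^sup>2 + h\<^sup>2))))"
          by (simp only:)
        then show ?thesis
          using True by (simp add: W_def gauss_mult flip: ennreal_mult')
      qed (simp add: W_def)
    qed
    also have "\<dots> = ennreal (2 / (sqrt pi * pi)) * ennreal (Gamma (3 / 2) * (1 + a\<^sup>2 + h\<^sup>2) powr (- (3 / 2)))"
      by (subst nn_integral_cmult, measurable, subst nn_integral_Gamma_scaled) (auto simp: add_pos_nonneg)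
    also have "\<dots> = ennreal ((1 + a\<^sup>2 + h\<^sup>2) powr (- (3 / 2)) / pi)"
      by (simp add: G flip: ennreal_mult')
    finally show ?thesis .
  qed
  have "(\<integral>\<^sup>+x. ennreal (csc_density k \<gamma> x) * indicator {x. u \<bullet> x \<le> c} x \<partial>lborel)
    = (\<integral>\<^sup>+x. (\<integral>\<^sup>+w. \<integral>\<^sup>+t. W t * ((\<Prod>b\<in>Basis. gauss t (x \<bullet> b)) *
        (gauss t w * ?L (w \<le> \<gamma> * (x \<bullet> axis k 1)) * ?L (u \<bullet> x \<le> c))) \<partial>lborel \<partial>lborel) \<partial>lborel)"
  proof (rule nn_integral_cong)
    fix x :: "real ^ 'n"
    show "ennreal (csc_density k \<gamma> x) * indicator {x. u \<bullet> x \<le> c} x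
      = (\<integral>\<^sup>+w. \<integral>\<^sup>+t. W t * ((\<Prod>b\<in>Basis. gauss t (x \<bullet> b)) *
        (gauss t w * ?L (w \<le> \<gamma> * (x \<bullet> axis k 1)) * ?L (u \<bullet> x \<le> c))) \<partial>lborel \<partial>lborel)"
    proof -
      have xk: "x $ k = x \<bullet> axis k 1" by (simp add: inner_axis)
      have ind: "indicator {x. u \<bullet> x \<le> c} x = ?L (u \<bullet> x \<le> c)" by simp
      have "ennreal (csc_density k \<gamma> x) * ?L (u \<bullet> x \<le> c)
        = (\<integral>\<^sup>+w. (?L (w \<le> \<gamma> * (x \<bullet> axis k 1)) * (\<integral>\<^sup>+t. W t *
          ((\<Prod>b\<in>Basis. gauss t (x \<bullet> b)) * gauss t w) \<partial>lborel)) * ?L (u \<bullet> x \<le> c) \<partial>lborel)"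
        unfolding csc_density_gauss_mixture W_def[symmetric] xk
        by (rule nn_integral_multc[symmetric]) measurable
      also have "\<dots> = (\<integral>\<^sup>+w. \<integral>\<^sup>+t. W t * ((\<Prod>b\<in>Basis. gauss t (x \<bullet> b)) *
        (gauss t w * ?L (w \<le> \<gamma> * (x \<bullet> axis k 1)) * ?L (u \<bullet> x \<le> c))) \<partial>lborel \<partial>lborel)"
        by (intro nn_integral_cong) (simp add: mult.assoc)
      finally show ?thesis unfolding ind .
    qed
  qed
  \<comment> \<open>\<open>t\<close> is brought outermost so that \<open>planar\<close> can be used
    at each fixed \<open>t\<close>, and afterwards innermost again so that \<open>kern\<close>
    removes it.\<close>
  also have "\<dots> = (\<integral>\<^sup>+x. (\<integral>\<^sup>+t. \<integral>\<^sup>+w. W t * ((\<Prod>b\<in>Basis. gauss t (x \<bullet> b)) *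
        (gauss t w * ?L (w \<le> \<gamma> * (x \<bullet> axis k 1)) * ?L (u \<bullet> x \<le> c))) \<partial>lborel \<partial>lborel) \<partial>lborel)"
    by (rule nn_integral_cong, rule lborel_pair.Fubini') measurable
  also have "\<dots> = (\<integral>\<^sup>+t. \<integral>\<^sup>+x. \<integral>\<^sup>+w. W t * ((\<Prod>b\<in>Basis. gauss t (x \<bullet> b)) *
        (gauss t w * ?L (w \<le> \<gamma> * (x \<bullet> axis k 1)) * ?L (u \<bullet> x \<le> c))) \<partial>lborel \<partial>lborel \<partial>lborel)"
    by (rule lborel_pair.Fubini') measurable
  also have "\<dots> = (\<integral>\<^sup>+t. W t * (\<integral>\<^sup>+x. (\<Prod>b\<in>Basis. gauss t (x \<bullet> b)) *
        ((\<integral>\<^sup>+w. gauss t w * ?L (w \<le> \<gamma> * (x \<bullet> axis k 1)) \<partial>lborel) * ?L (u \<bullet> x \<le> c)) \<partial>lborel) \<partial>lborel)"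
    by (rule nn_integral_cong, subst nn_integral_cmult[symmetric], measurable,
        rule nn_integral_cong, subst nn_integral_multc[symmetric], measurable,
        (subst nn_integral_cmult[symmetric], measurable)+)
  also have "\<dots> = (\<integral>\<^sup>+t. W t * (\<integral>\<^sup>+a. \<integral>\<^sup>+h. ?K t a h \<partial>lborel \<partial>lborel) \<partial>lborel)"
  proof (rule nn_integral_cong)
    fix t :: real
    show "W t * (\<integral>\<^sup>+x. (\<Prod>b\<in>Basis. gauss t (x \<bullet> b)) *
        ((\<integral>\<^sup>+w. gauss t w * ?L (w \<le> \<gamma> * (x \<bullet> axis k 1)) \<partial>lborel) * ?L (u \<bullet> x \<le> c)) \<partial>lborel)
      = W t * (\<integral>\<^sup>+a. \<integral>\<^sup>+h. ?K t a h \<partial>lborel \<partial>lborel)"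
    \<comment> \<open>\<open>planar\<close> holds only for positive \<open>t\<close>; elsewhere the
      weight \<open>W t\<close> is 0.\<close>
    proof (cases "t > 0")
      case True
      then show ?thesis by (simp only: planar)
    qed (simp add: W_def)
  qed
  also have "\<dots> = (\<integral>\<^sup>+t. \<integral>\<^sup>+a. \<integral>\<^sup>+h. W t * ?K t a h \<partial>lborel \<partial>lborel \<partial>lborel)"
    by (rule nn_integral_cong, subst nn_integral_cmult[symmetric], measurable,
        rule nn_integral_cong, subst nn_integral_cmult[symmetric], measurable)
  also have "\<dots> = (\<integral>\<^sup>+a. \<integral>\<^sup>+t. \<integral>\<^sup>+h. W t * ?K t a h \<partial>lborel \<partial>lborel \<partial>lborel)"
    by (rule lborel_pair.Fubini') measurable
  also have "\<dots> = (\<integral>\<^sup>+a. \<integral>\<^sup>+h. \<integral>\<^sup>+t. W t * ?K t a h \<partial>lborel \<partial>lborel \<partial>lborel)"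
    by (rule nn_integral_cong, rule lborel_pair.Fubini') measurable
  also have "\<dots> = (\<integral>\<^sup>+a. \<integral>\<^sup>+h. ?L (0 \<le> a \<and> \<rho> * a + sqrt (1 - \<rho>\<^sup>2) * h \<le> c) *
      ennreal ((1 + a\<^sup>2 + h\<^sup>2) powr (- (3 / 2)) / pi) \<partial>lborel \<partial>lborel)"
  proof (intro nn_integral_cong)
    fix a h :: real
    have "(\<integral>\<^sup>+t. W t * ?K t a h \<partial>lborel) = (\<integral>\<^sup>+t. W t * (gauss t a * gauss t h) *
        ?L (0 \<le> a \<and> \<rho> * a + sqrt (1 - \<rho>\<^sup>2) * h \<le> c) \<partial>lborel)"
      by (simp only: mult.assoc)
    also have "\<dots> = (\<integral>\<^sup>+t. W t * (gauss t a * gauss t h) \<partial>lborel) *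
        ?L (0 \<le> a \<and> \<rho> * a + sqrt (1 - \<rho>\<^sup>2) * h \<le> c)"
      by (rule nn_integral_multc) measurable
    finally show "(\<integral>\<^sup>+t. W t * ?K t a h \<partial>lborel) = ?L (0 \<le> a \<and> \<rho> * a + sqrt (1 - \<rho>\<^sup>2) * h \<le> c) *
      ennreal ((1 + a\<^sup>2 + h\<^sup>2) powr (- (3 / 2)) / pi)"
      by (simp only: kern mult.commute)
  qed
  finally show ?thesis .
qed

section \<open>The planar integral and the univariate skew-Cauchy law\<close>

text \<open>This is the inner integral over \<open>a\<close> in the planar Cauchy integral once the
  square in \<open>a\<close> has been completed.\<close>

lemma nn_integral_powr_minus_three_halves:
  fixes B m :: real
  assumes B: "B > 0"
  shows "(\<integral>\<^sup>+a. ennreal (((a - m)\<^sup>2 + B) powr (- (3 / 2))) * indicator {0..} a \<partial>lborel)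
       = ennreal ((1 + m / sqrt (m\<^sup>2 + B)) / B)"
proof -
  \<comment> \<open>The elementary antiderivative of the shifted power. It tends to
    \<open>1 / B\<close> at infinity, and its value at 0 contributes the term with
    \<open>m\<close>.\<close>
  define F where "F = (\<lambda>a. (a - m) / (B * sqrt ((a - m)\<^sup>2 + B)))"
  have pos: "(a - m)\<^sup>2 + B > 0" for a
    using B by (simp add: add_nonneg_pos)
  have "(F has_real_derivative ((a - m)\<^sup>2 + B) powr (- (3 / 2))) (at a)" for a
  proof -
    define R where "R = sqrt ((a - m)\<^sup>2 + B)"
    have R: "R > 0" and R2: "R\<^sup>2 = (a - m)\<^sup>2 + B"
      using pos[of a] by (auto simp: R_def)
    have "((a - m)\<^sup>2 + B) powr (- (3 / 2)) = (R powr 2) powr (- (3 / 2))"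
      using R R2 by simp
    also have "\<dots> = 1 / R ^ 3"
      using R by (simp only: powr_powr) (simp add: powr_minus_divide)
    also have "\<dots> = (R\<^sup>2 - (a - m)\<^sup>2) / (B * R ^ 3)"
      using B by (simp add: R2)
    also have "\<dots> = (1 * (B * R) - (a - m) * (B * ((a - m) / R))) / (B * R * (B * R))"
    proof -
      have "1 * (B * R) - y * (B * (y / R)) = B * (R\<^sup>2 - y\<^sup>2) / R" for y
        using R by (simp add: field_simps power2_eq_square)
      then show ?thesis
        using B R by (simp only:) (simp add: power3_eq_cube)
    qed
    finally have eq: "((a - m)\<^sup>2 + B) powr (- (3 / 2)) =
      (1 * (B * R) - (a - m) * (B * ((a - m) / R))) / (B * R * (B * R))" .
    have "((\<lambda>a. sqrt ((a - m)\<^sup>2 + B)) has_real_derivative (a - m) / R) (at a)"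
    proof -
      have "((\<lambda>a. (a - m)\<^sup>2 + B) has_real_derivative 2 * (a - m)) (at a)"
        by (auto intro!: derivative_eq_intros)
      from DERIV_chain2[OF DERIV_real_sqrt[OF pos] this]
      have "((\<lambda>a. sqrt ((a - m)\<^sup>2 + B)) has_real_derivative inverse R / 2 * (2 * (a - m))) (at a)"
        unfolding R_def .
      moreover have "inverse R / 2 * (2 * y) = y / R" for y
        by (simp add: inverse_eq_divide)
      ultimately show ?thesis by (simp only:)
    qed
    moreover have "((\<lambda>a. a - m) has_real_derivative 1) (at a)"
      using DERIV_diff[OF DERIV_ident DERIV_const[of m]] by simp
    ultimately have "(F has_real_derivative
        (1 * (B * sqrt ((a - m)\<^sup>2 + B)) - (a - m) * (B * ((a - m) / R))) /
        (B * sqrt ((a - m)\<^sup>2 + B) * (B * sqrt ((a - m)\<^sup>2 + B)))) (at a)"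
      unfolding F_def using B pos[of a]
      by (intro DERIV_divide DERIV_cmult) (simp_all only: mult_eq_0_iff real_sqrt_eq_0_iff, simp)
    then show ?thesis
      unfolding eq R_def .
  qed
  moreover have "(F \<longlongrightarrow> 1 / B) at_top"
  proof -
    have "(F \<longlongrightarrow> inverse B) at_top"
      unfolding F_def using B by real_asymp
    then show ?thesis by (simp add: inverse_eq_divide)
  qed
  ultimately have "(\<integral>\<^sup>+a. ennreal (((a - m)\<^sup>2 + B) powr (- (3 / 2))) * indicator {0..} a \<partial>lborel)
       = ennreal (1 / B - F 0)"
    by (intro nn_integral_FTC_atLeast) auto
  also have "1 / B - F 0 = (1 + m / sqrt (m\<^sup>2 + B)) / B"
    by (simp add: F_def add_divide_distrib mult.commute)
  finally show ?thesis .
qed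

text \<open>
  The distribution function and density of \<open>CSC\<^sub>1(\<gamma>)\<close> in terms of
  \<open>\<rho> = \<gamma> / sqrt (1 + \<gamma>\<^sup>2)\<close>. The closed form is the area of a right-angled spherical triangle,
  cut off from a quarter-sphere by a plane, relative to the area \<open>\<pi>\<close> of the quarter-sphere.
\<close>

definition sc_cdf :: "real \<Rightarrow> real \<Rightarrow> real" where
  "sc_cdf \<rho> c = (arctan c + arccos (\<rho> / sqrt (1 + c\<^sup>2))) / pi"

definition sc_density :: "real \<Rightarrow> real \<Rightarrow> real" where
  "sc_density \<rho> z = (1 + \<rho> * z / sqrt (z\<^sup>2 + 1 - \<rho>\<^sup>2)) / (pi * (1 + z\<^sup>2))"

text \<open>For \<open>|\<rho>| < 1\<close> the square of \<open>\<rho> * z\<close> is strictly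
  below \<open>z^2 + 1 - \<rho>^2\<close>, so the fraction stays above -1. Strictness is what makes
  the distribution function strictly increasing.\<close>

lemma sc_density_pos:
  assumes \<rho>: "\<bar>\<rho>\<bar> < 1"
  shows "sc_density \<rho> z > 0"
proof -
  have r2: "\<rho>\<^sup>2 < 1" using \<rho> by (simp add: abs_square_less_1)
  have pos: "z\<^sup>2 + 1 - \<rho>\<^sup>2 > 0" using r2 by (smt (verit) zero_le_power2)
  have "\<bar>\<rho> * z\<bar> < sqrt (z\<^sup>2 + 1 - \<rho>\<^sup>2)"
  proof (rule real_less_rsqrt)
    have "\<rho>\<^sup>2 * z\<^sup>2 \<le> 1 * z\<^sup>2" using r2 by (intro mult_right_mono) auto
    then show "\<bar>\<rho> * z\<bar>\<^sup>2 < z\<^sup>2 + 1 - \<rho>\<^sup>2" using r2 by (simp add: power_mult_distrib)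
  qed
  then have "\<bar>\<rho> * z / sqrt (z\<^sup>2 + 1 - \<rho>\<^sup>2)\<bar> < 1"
    using pos by (simp add: abs_divide)
  then have "1 + \<rho> * z / sqrt (z\<^sup>2 + 1 - \<rho>\<^sup>2) > 0"
    by linarith
  then show ?thesis
    unfolding sc_density_def by (intro divide_pos_pos mult_pos_pos) (auto simp: add_pos_nonneg)
qed

text \<open>\<open>|\<rho>| < 1\<close> keeps the argument of \<open>arccos\<close> strictly between
  -1 and 1, where \<open>arccos\<close> is differentiable.\<close>

lemma has_real_derivative_sc_cdf:
  assumes \<rho>: "\<bar>\<rho>\<bar> < 1"
  shows "(sc_cdf \<rho> has_real_derivative sc_density \<rho> z) (at z)"
proof -
  define R where "R = sqrt (1 + z\<^sup>2)"
  have R: "R > 0" and R2: "R\<^sup>2 = 1 + z\<^sup>2" by (auto simp: R_def add_pos_nonneg)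
  have R1: "R \<ge> 1" by (simp add: R_def)
  have lt: "\<bar>\<rho> / R\<bar> < 1"
    using \<rho> R R1 by (simp add: abs_divide)
  have r2: "\<rho>\<^sup>2 < 1" using \<rho> by (simp add: abs_square_less_1)
  have pos: "z\<^sup>2 + 1 - \<rho>\<^sup>2 > 0" using r2 by (smt (verit) zero_le_power2)
  have sq: "sqrt (1 - (\<rho> / R)\<^sup>2) = sqrt (z\<^sup>2 + 1 - \<rho>\<^sup>2) / R"
  proof -
    have "1 - (\<rho> / R)\<^sup>2 = (z\<^sup>2 + 1 - \<rho>\<^sup>2) / R\<^sup>2"
      using R R2 by (simp add: power_divide diff_divide_distrib add_divide_distrib)
         (metis R2 add_divide_distrib add.commute divide_self_if less_irrefl power_not_zero)
    then show ?thesis using R by (simp add: real_sqrt_divide)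
  qed
  have "(sc_cdf \<rho> has_real_derivative
     (inverse (1 + z\<^sup>2) + inverse (- sqrt (1 - (\<rho> / R)\<^sup>2)) * (- (\<rho> * (z / R)) / (R * R))) / pi) (at z)"
  proof -
    have pos1: "1 + z\<^sup>2 > 0" by (simp add: add_pos_nonneg)
    have "((\<lambda>z. sqrt (1 + z\<^sup>2)) has_real_derivative z / R) (at z)"
      unfolding R_def using pos1 by (auto intro!: derivative_eq_intros simp: field_simps)
    then have "((\<lambda>z. \<rho> / sqrt (1 + z\<^sup>2)) has_real_derivative
        (0 * sqrt (1 + z\<^sup>2) - \<rho> * (z / R)) / (sqrt (1 + z\<^sup>2) * sqrt (1 + z\<^sup>2))) (at z)"
      using pos1 by (intro DERIV_divide DERIV_const) auto
    then have "((\<lambda>z. \<rho> / sqrt (1 + z\<^sup>2)) has_real_derivative - (\<rho> * (z / R)) / (R * R)) (at z)"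
      by (simp add: R_def)
    moreover have "(arccos has_real_derivative inverse (- sqrt (1 - (\<rho> / R)\<^sup>2))) (at (\<rho> / sqrt (1 + z\<^sup>2)))"
      using DERIV_arccos[of "\<rho> / R"] lt unfolding R_def by linarith
    ultimately show ?thesis
      unfolding sc_cdf_def[abs_def] by (intro DERIV_cdivide DERIV_add DERIV_arctan DERIV_chain2)
  qed
  moreover have "(inverse (1 + z\<^sup>2) + inverse (- sqrt (1 - (\<rho> / R)\<^sup>2)) * (- (\<rho> * (z / R)) / (R * R))) / pi
     = sc_density \<rho> z"
  proof -
    define Q where "Q = sqrt (z\<^sup>2 + 1 - \<rho>\<^sup>2)"
    have Q: "Q > 0" using pos by (simp add: Q_def)
    have "(inverse (R\<^sup>2) + inverse (- (Q / R)) * (- (\<rho> * (z / R)) / (R * R))) / pi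
       = (1 + \<rho> * z / Q) / (pi * R\<^sup>2)"
      using Q R by (simp add: field_simps power2_eq_square)
    then show ?thesis unfolding sq sc_density_def Q_def[symmetric] R2 .
  qed
  ultimately show ?thesis by simp
qed

lemma measurable_sc_density [measurable]: "sc_density \<rho> \<in> borel_measurable borel"
  unfolding sc_density_def[abs_def] by measurable

text \<open>Besides having the right derivative, \<open>sc_cdf\<close> vanishes at minus infinity:
  \<open>arctan\<close> tends to \<open>- pi / 2\<close> and the \<open>arccos\<close> term to
  \<open>arccos 0 = pi / 2\<close>.\<close>

lemma nn_integral_sc_density:
  assumes \<rho>: "\<bar>\<rho>\<bar> < 1"
  shows "(\<integral>\<^sup>+z. (if z \<le> c then 1 else 0) * ennreal (sc_density \<rho> z) \<partial>lborel) = ennreal (sc_cdf \<rho> c)"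
proof -
  \<comment> \<open>The reflection of \<open>z\<close> turns the lower half-line into one reaching
    to plus infinity, the form needed for the fundamental theorem of calculus.\<close>
  have "(\<integral>\<^sup>+z. (if z \<le> c then 1 else 0) * ennreal (sc_density \<rho> z) \<partial>lborel)
     = (\<integral>\<^sup>+x. ennreal (sc_density \<rho> (- x)) * indicator {- c..} x \<partial>lborel)"
    by (subst nn_integral_real_affine[where t=0 and c="-1"])
       (auto intro!: nn_integral_cong simp: indicator_def)
  also have "\<dots> = ennreal (0 - (- sc_cdf \<rho> (- (- c))))"
  proof (rule nn_integral_FTC_atLeast[where F = "\<lambda>x. - sc_cdf \<rho> (- x)"])
    show "((\<lambda>x. - sc_cdf \<rho> (- x)) has_real_derivative sc_density \<rho> (- x)) (at x)" for x
    proof -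
      have "((\<lambda>x. sc_cdf \<rho> (- x)) has_real_derivative sc_density \<rho> (- x) * - 1) (at x)"
        by (rule DERIV_chain2[OF has_real_derivative_sc_cdf[OF \<rho>]]) (auto intro!: derivative_eq_intros)
      from DERIV_minus[OF this] show ?thesis by simp
    qed
    have "((\<lambda>x. \<rho> / sqrt (1 + (- x)\<^sup>2)) \<longlongrightarrow> 0) at_top"
      by real_asymp
    then have "((\<lambda>x. arccos (\<rho> / sqrt (1 + (- x)\<^sup>2))) \<longlongrightarrow> arccos 0) at_top"
      by (rule isCont_tendsto_compose[OF isCont_arccos, rotated 2]) auto
    then have "((\<lambda>x. - ((- arctan x + arccos (\<rho> / sqrt (1 + (- x)\<^sup>2))) / pi)) \<longlongrightarrow> - ((- (pi / 2) + arccos 0) / pi)) at_top"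
      by (intro tendsto_intros tendsto_arctan_at_top) auto
    then show "((\<lambda>x. - sc_cdf \<rho> (- x)) \<longlongrightarrow> 0) at_top"
      by (simp add: sc_cdf_def arctan_minus)
    show "0 \<le> sc_density \<rho> (- x)" for x
      using sc_density_pos[OF \<rho>, of "- x"] by simp
  qed auto
  finally show ?thesis by simp
qed

lemma sc_cdf_strict_mono:
  assumes "\<bar>\<rho>\<bar> < 1" "a < b"
  shows "sc_cdf \<rho> a < sc_cdf \<rho> b"
  by (rule DERIV_pos_imp_increasing[OF assms(2)])
     (use has_real_derivative_sc_cdf[OF assms(1)] sc_density_pos[OF assms(1)] in blast)

text \<open>With \<open>c\<close> the proposed quantile,
  \<open>\<rho> = c * cos \<theta> - sin \<theta>\<close>. Multiplying by
  \<open>cos (arctan c)\<close> gives the sine of \<open>arctan c - \<theta>\<close>, that is, the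
  cosine of \<open>pi / 2 + \<theta> - arctan c\<close>. Undoing the cosine cancels
  \<open>arctan c\<close> in \<open>sc_cdf\<close>.\<close>

lemma sc_cdf_quantile:
  assumes \<rho>: "\<bar>\<rho>\<bar> < 1" and \<theta>: "0 \<le> \<theta>" "\<theta> < pi / 2"
  shows "sc_cdf \<rho> (\<rho> / cos \<theta> + tan \<theta>) = 1 / 2 + \<theta> / pi"
proof -
  define c where "c = \<rho> / cos \<theta> + tan \<theta>"
  have cos: "cos \<theta> > 0" using \<theta> by (intro cos_gt_zero_pi) auto
  have ccos: "c * cos \<theta> = \<rho> + sin \<theta>"
    using cos by (simp add: c_def tan_def field_simps)
  then have "\<rho> / sqrt (1 + c\<^sup>2) = sin (arctan c) * cos \<theta> - cos (arctan c) * sin \<theta>"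
    by (simp add: sin_arctan cos_arctan diff_divide_distrib[symmetric])
  also have "\<dots> = cos (pi / 2 + \<theta> - arctan c)"
    by (simp add: cos_diff cos_add sin_add)
  finally have eq: "\<rho> / sqrt (1 + c\<^sup>2) = cos (pi / 2 + \<theta> - arctan c)" .
  \<comment> \<open>To undo the cosine, the angle must not exceed \<open>pi\<close>. For positive
    \<theta> the bound says that \<open>c\<close> exceeds
    \<open>- cos \<theta> / sin \<theta>\<close>, which amounts to
    \<open>\<rho> * sin \<theta> > -1\<close>; at \<open>\<theta> = 0\<close> that quotient is
    meaningless and the range of \<open>arctan\<close> suffices.\<close>
  have "\<theta> - pi / 2 < arctan c"
  proof (cases "\<theta> = 0")
    case True
    then show ?thesis using arctan_lbound[of c] by simp
  next
    case False
    then have sin: "sin \<theta> > 0" using \<theta> by (intro sin_gt_zero) auto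
    have "\<bar>\<rho> * sin \<theta>\<bar> < 1"
      using \<rho> sin by (auto simp: abs_mult intro: mult_less_le_imp_less[of "\<bar>\<rho>\<bar>" 1 "sin \<theta>" 1, simplified])
    then have "- (cos \<theta> * cos \<theta>) < (c * cos \<theta>) * sin \<theta>"
      unfolding ccos distrib_right using sin_cos_squared_add[of \<theta>, unfolded power2_eq_square] by linarith
    then have "cos \<theta> * (- cos \<theta>) < cos \<theta> * (c * sin \<theta>)"
      by (simp only: mult_ac mult_minus_right)
    then have "- cos \<theta> < c * sin \<theta>"
      by (simp only: mult_less_cancel_left_pos[OF cos])
    then have "- cos \<theta> / sin \<theta> < c"
      by (simp only: pos_divide_less_eq[OF sin])
    also have "- cos \<theta> / sin \<theta> = tan (\<theta> - pi / 2)"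
      by (simp add: tan_def sin_diff cos_diff)
    finally have "tan (\<theta> - pi / 2) < c" .
    then have "arctan (tan (\<theta> - pi / 2)) < arctan c"
      by (simp only: arctan_less_iff)
    then show ?thesis
      using \<theta> False by (subst (asm) arctan_tan) auto
  qed
  then have "arccos (\<rho> / sqrt (1 + c\<^sup>2)) = pi / 2 + \<theta> - arctan c"
    unfolding eq using \<theta> arctan_ubound[of c] by (intro arccos_cos) auto
  then show ?thesis by (simp add: sc_cdf_def c_def[symmetric] add_divide_distrib)
qed

text \<open>Replacing \<open>h\<close> by the linear form \<open>z\<close> makes the event a
  quadrant-like set in \<open>(a, z)\<close>. Integrating over \<open>a \<ge> 0\<close> leaves the
  density of \<open>z\<close>, which is \<open>sc_density\<close>.\<close>

lemma nn_integral_planar_Cauchy: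
  assumes \<rho>: "\<bar>\<rho>\<bar> < 1"
  shows "(\<integral>\<^sup>+a. \<integral>\<^sup>+h. (if 0 \<le> a \<and> \<rho> * a + sqrt (1 - \<rho>\<^sup>2) * h \<le> c then 1 else 0) *
      ennreal ((1 + a\<^sup>2 + h\<^sup>2) powr (- (3 / 2)) / pi) \<partial>lborel \<partial>lborel) = ennreal (sc_cdf \<rho> c)"
proof -
  define \<sigma> where "\<sigma> = sqrt (1 - \<rho>\<^sup>2)"
  have r2: "\<rho>\<^sup>2 < 1" using \<rho> by (simp add: abs_square_less_1)
  have \<sigma>: "\<sigma> > 0" and \<sigma>2: "\<sigma>\<^sup>2 = 1 - \<rho>\<^sup>2" using r2 by (auto simp: \<sigma>_def)
  have "(\<integral>\<^sup>+a. \<integral>\<^sup>+h. (if 0 \<le> a \<and> \<rho> * a + \<sigma> * h \<le> c then 1 else 0) *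
      ennreal ((1 + a\<^sup>2 + h\<^sup>2) powr (- (3 / 2)) / pi) \<partial>lborel \<partial>lborel)
    = (\<integral>\<^sup>+a. \<integral>\<^sup>+z. (if 0 \<le> a \<and> z \<le> c then 1 else 0) *
      ennreal (\<sigma>\<^sup>2 / pi * ((a - \<rho> * z)\<^sup>2 + \<sigma>\<^sup>2 * (1 + z\<^sup>2)) powr (- (3 / 2))) \<partial>lborel \<partial>lborel)"
  proof (rule nn_integral_cong)
    fix a :: real
    have kern: "1 / \<sigma> * ((1 + a\<^sup>2 + ((z - \<rho> * a) / \<sigma>)\<^sup>2) powr (- (3 / 2)) / pi)
       = \<sigma>\<^sup>2 / pi * ((a - \<rho> * z)\<^sup>2 + \<sigma>\<^sup>2 * (1 + z\<^sup>2)) powr (- (3 / 2))" for z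
    proof -
      define Q where "Q = (a - \<rho> * z)\<^sup>2 + \<sigma>\<^sup>2 * (1 + z\<^sup>2)"
      have Q: "Q > 0" unfolding Q_def using \<sigma> by (intro add_nonneg_pos mult_pos_pos add_pos_nonneg) auto
      \<comment> \<open>Completing the square in \<open>a\<close> works because the coefficient of
        \<open>a^2\<close> is \<open>\<sigma>^2 + \<rho>^2 = 1\<close>.\<close>
      have "\<sigma>\<^sup>2 + \<sigma>\<^sup>2 * a\<^sup>2 + (z - \<rho> * a)\<^sup>2 = Q"
        unfolding Q_def \<sigma>2 by (simp add: power2_eq_square algebra_simps)
      then have "1 + a\<^sup>2 + ((z - \<rho> * a) / \<sigma>)\<^sup>2 = Q / \<sigma>\<^sup>2"
        using \<sigma> by (simp add: field_simps)
      then have "(1 + a\<^sup>2 + ((z - \<rho> * a) / \<sigma>)\<^sup>2) powr (- (3 / 2)) = Q powr (- (3 / 2)) * (\<sigma> powr 2) powr (3 / 2)"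
        using Q \<sigma> by (simp add: powr_divide powr_minus divide_simps)
      also have "(\<sigma> powr 2) powr (3 / 2) = \<sigma> ^ 3"
        using \<sigma> by (simp only: powr_powr) simp
      finally show ?thesis
        using \<sigma> unfolding Q_def by (simp add: power3_eq_cube power2_eq_square)
    qed
    have "(\<integral>\<^sup>+h. (if 0 \<le> a \<and> \<rho> * a + \<sigma> * h \<le> c then 1 else 0) *
        ennreal ((1 + a\<^sup>2 + h\<^sup>2) powr (- (3 / 2)) / pi) \<partial>lborel)
      = (\<integral>\<^sup>+z. ennreal (1 / \<sigma>) * ((if 0 \<le> a \<and> \<rho> * a + \<sigma> * ((z - \<rho> * a) / \<sigma>) \<le> c then 1 else 0) *
        ennreal ((1 + a\<^sup>2 + ((z - \<rho> * a) / \<sigma>)\<^sup>2) powr (- (3 / 2)) / pi)) \<partial>lborel)"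
      by (subst nn_integral_real_affine[where t="- (\<rho> * a) / \<sigma>" and c="1 / \<sigma>"])
         (use \<sigma> in \<open>auto simp: nn_integral_cmult diff_divide_distrib\<close>)
    also have "\<dots> = (\<integral>\<^sup>+z. (if 0 \<le> a \<and> z \<le> c then 1 else 0) *
      ennreal (1 / \<sigma> * ((1 + a\<^sup>2 + ((z - \<rho> * a) / \<sigma>)\<^sup>2) powr (- (3 / 2)) / pi)) \<partial>lborel)"
      using \<sigma> by (intro nn_integral_cong) (auto simp flip: ennreal_mult')
    finally show "(\<integral>\<^sup>+h. (if 0 \<le> a \<and> \<rho> * a + \<sigma> * h \<le> c then 1 else 0) *
        ennreal ((1 + a\<^sup>2 + h\<^sup>2) powr (- (3 / 2)) / pi) \<partial>lborel)
      = (\<integral>\<^sup>+z. (if 0 \<le> a \<and> z \<le> c then 1 else 0) *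
      ennreal (\<sigma>\<^sup>2 / pi * ((a - \<rho> * z)\<^sup>2 + \<sigma>\<^sup>2 * (1 + z\<^sup>2)) powr (- (3 / 2))) \<partial>lborel)"
      unfolding kern .
  qed
  also have "\<dots> = (\<integral>\<^sup>+z. \<integral>\<^sup>+a. (if 0 \<le> a \<and> z \<le> c then 1 else 0) *
      ennreal (\<sigma>\<^sup>2 / pi * ((a - \<rho> * z)\<^sup>2 + \<sigma>\<^sup>2 * (1 + z\<^sup>2)) powr (- (3 / 2))) \<partial>lborel \<partial>lborel)"
    by (rule lborel_pair.Fubini') measurable
  also have "\<dots> = (\<integral>\<^sup>+z. (if z \<le> c then 1 else 0) * ennreal (sc_density \<rho> z) \<partial>lborel)"
  proof (rule nn_integral_cong)
    fix z :: real
    define B where "B = \<sigma>\<^sup>2 * (1 + z\<^sup>2)"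
    have B: "B > 0" using \<sigma> by (simp add: B_def add_pos_nonneg)
    have "(\<integral>\<^sup>+a. (if 0 \<le> a \<and> z \<le> c then 1 else 0) *
      ennreal (\<sigma>\<^sup>2 / pi * ((a - \<rho> * z)\<^sup>2 + B) powr (- (3 / 2))) \<partial>lborel)
      = (\<integral>\<^sup>+a. ((if z \<le> c then 1 else 0) * ennreal (\<sigma>\<^sup>2 / pi)) *
         (ennreal (((a - \<rho> * z)\<^sup>2 + B) powr (- (3 / 2))) * indicator {0..} a) \<partial>lborel)"
      by (intro nn_integral_cong) (auto simp: indicator_def simp flip: ennreal_mult')
    also have "\<dots> = ((if z \<le> c then 1 else 0) * ennreal (\<sigma>\<^sup>2 / pi)) *
        ennreal ((1 + \<rho> * z / sqrt ((\<rho> * z)\<^sup>2 + B)) / B)"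
      by (subst nn_integral_cmult) (simp_all add: nn_integral_powr_minus_three_halves[OF B])
    also have "\<dots> = (if z \<le> c then 1 else 0) * ennreal (\<sigma>\<^sup>2 / pi *
        ((1 + \<rho> * z / sqrt ((\<rho> * z)\<^sup>2 + B)) / B))"
      by (auto simp flip: ennreal_mult')
    also have "(\<rho> * z)\<^sup>2 + B = z\<^sup>2 + 1 - \<rho>\<^sup>2"
      by (simp add: B_def \<sigma>2 power_mult_distrib algebra_simps)
    also have "\<sigma>\<^sup>2 / pi * ((1 + \<rho> * z / sqrt (z\<^sup>2 + 1 - \<rho>\<^sup>2)) / B) = sc_density \<rho> z"
      using \<sigma> by (simp add: B_def sc_density_def mult.commute)
    finally show "(\<integral>\<^sup>+a. (if 0 \<le> a \<and> z \<le> c then 1 else 0) *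
      ennreal (\<sigma>\<^sup>2 / pi * ((a - \<rho> * z)\<^sup>2 + \<sigma>\<^sup>2 * (1 + z\<^sup>2)) powr (- (3 / 2))) \<partial>lborel)
      = (if z \<le> c then 1 else 0) * ennreal (sc_density \<rho> z)"
      by (simp add: B_def)
  qed
  also have "\<dots> = ennreal (sc_cdf \<rho> c)"
    by (rule nn_integral_sc_density[OF \<rho>])
  finally show ?thesis by (simp add: \<sigma>_def)
qed

text \<open>With \<open>\<phi> = arctan c\<close> the argument of \<open>arccos\<close> is
  \<open>\<rho> * cos \<phi>\<close>, at most \<open>cos \<bar>\<phi>\<bar>\<close>, so the
  \<open>arccos\<close> term is at least the modulus of \<phi>. Nonnegativity is needed to recover a
  real equation from one between \<open>ennreal\<close> values.\<close>

lemma sc_cdf_nonneg: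
  assumes \<rho>: "\<bar>\<rho>\<bar> < 1"
  shows "sc_cdf \<rho> c \<ge> 0"
proof -
  define \<phi> where "\<phi> = arctan c"
  have \<phi>: "- (pi / 2) < \<phi>" "\<phi> < pi / 2"
    using arctan_bounded[of c] by (auto simp: \<phi>_def)
  then have cos: "cos \<phi> > 0" by (intro cos_gt_zero_pi) auto
  have "\<bar>\<rho> * cos \<phi>\<bar> \<le> cos \<phi>"
    using \<rho> cos by (simp add: abs_mult)
  then have "arccos (cos \<bar>\<phi>\<bar>) \<le> arccos (\<rho> * cos \<phi>)"
    using cos_le_one[of \<phi>] unfolding cos_abs_real by (intro arccos_le_arccos) linarith+
  moreover have "arccos (cos \<bar>\<phi>\<bar>) = \<bar>\<phi>\<bar>"
    using \<phi> by (intro arccos_cos) auto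
  ultimately have "0 \<le> \<phi> + arccos (\<rho> * cos \<phi>)"
    by linarith
  then show ?thesis
    by (simp add: sc_cdf_def \<phi>_def cos_arctan)
qed

section \<open>Half-space probabilities and their quantiles\<close>

text \<open>The bound holds because \<open>\<gamma>^2 < 1 + \<gamma>^2\<close> and a coordinate of a
  unit vector is at most 1 in modulus. It is exported because strict monotonicity and the quantile
  formula for \<open>sc_cdf\<close> both depend on it.\<close>

lemma csc_halfspace_prob:
  fixes X :: "'w \<Rightarrow> real ^ 'n::finite" and k :: 'n
  assumes M: "prob_space M"
    and X: "distributed M lborel X (\<lambda>x. ennreal (csc_density k \<gamma> x))"
    and u: "norm u = 1"
  shows "\<bar>\<gamma> / sqrt (1 + \<gamma>\<^sup>2) * u $ k\<bar> < 1"
    and "\<P>(\<omega> in M. u \<bullet> X \<omega> \<le> c) = sc_cdf (\<gamma> / sqrt (1 + \<gamma>\<^sup>2) * u $ k) c"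
proof -
  interpret prob_space M by fact
  define \<rho> where "\<rho> = \<gamma> / sqrt (1 + \<gamma>\<^sup>2) * u $ k"
  have "\<bar>\<gamma>\<bar> < sqrt (1 + \<gamma>\<^sup>2)"
    by (rule real_less_rsqrt) simp
  moreover from this have "0 < sqrt (1 + \<gamma>\<^sup>2)"
    by linarith
  ultimately have "\<bar>\<gamma> / sqrt (1 + \<gamma>\<^sup>2)\<bar> < 1"
    by (simp add: abs_divide)
  moreover have "\<bar>u $ k\<bar> \<le> 1"
    using component_le_norm_cart[of u k] u by simp
  ultimately have \<rho>: "\<bar>\<rho>\<bar> < 1"
    unfolding \<rho>_def abs_mult
    by (smt (verit) abs_ge_zero mult_left_le)
  then show "\<bar>\<gamma> / sqrt (1 + \<gamma>\<^sup>2) * u $ k\<bar> < 1"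
    by (simp only: \<rho>_def)
  have sets: "{x. u \<bullet> x \<le> c} \<in> sets lborel"
    by (simp add: borel_closed closed_halfspace_le)
  have "emeasure M (X -` {x. u \<bullet> x \<le> c} \<inter> space M) = ennreal (sc_cdf \<rho> c)"
    unfolding distributed_emeasure[OF X sets] \<rho>_def
    by (subst nn_integral_csc_halfspace[OF u distributed_borel_measurable[OF X]],
        rule nn_integral_planar_Cauchy, rule \<rho>[unfolded \<rho>_def])
  moreover have "X -` {x. u \<bullet> x \<le> c} \<inter> space M = {\<omega> \<in> space M. u \<bullet> X \<omega> \<le> c}"
    by auto
  moreover have "sc_cdf \<rho> c \<ge> 0"
    by (rule sc_cdf_nonneg[OF \<rho>])
  ultimately show "\<P>(\<omega> in M. u \<bullet> X \<omega> \<le> c) = sc_cdf (\<gamma> / sqrt (1 + \<gamma>\<^sup>2) * u $ k) c"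
    by (simp add: emeasure_eq_measure \<rho>_def)
qed

text \<open>Dividing by the norm reduces the event to a unit direction. There strict monotonicity of
  \<open>sc_cdf\<close> turns the comparison of probabilities into a comparison of thresholds, and
  multiplying back by the norm gives a support function.\<close>

lemma csc_halfspace_quantile:
  fixes X :: "'w \<Rightarrow> real ^ 'n::finite" and k :: 'n
  assumes M: "prob_space M"
    and X: "distributed M lborel X (\<lambda>x. ennreal (csc_density k \<gamma> x))"
    and u: "u \<noteq> 0" and \<theta>: "0 \<le> \<theta>" "\<theta> < pi / 2"
  shows "\<P>(\<omega> in M. u \<bullet> X \<omega> \<le> c) \<ge> 1 / 2 + \<theta> / pi \<longleftrightarrow>
    c \<ge> u $ k * (\<gamma> / sqrt (1 + \<gamma>\<^sup>2) / cos \<theta>) + norm u * tan \<theta>"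
proof -
  define v where "v = u /\<^sub>R norm u"
  define \<rho> where "\<rho> = \<gamma> / sqrt (1 + \<gamma>\<^sup>2) * v $ k"
  have n: "norm u > 0" using u by simp
  have v: "norm v = 1" using u by (simp add: v_def)
  have "u \<bullet> x \<le> c \<longleftrightarrow> v \<bullet> x \<le> c / norm u" for x
    using n by (simp add: v_def field_simps)
  then have "\<P>(\<omega> in M. u \<bullet> X \<omega> \<le> c) = sc_cdf \<rho> (c / norm u)"
    using csc_halfspace_prob(2)[OF M X v, of "c / norm u"] by (simp add: \<rho>_def)
  moreover have \<rho>: "\<bar>\<rho>\<bar> < 1"
    unfolding \<rho>_def by (rule csc_halfspace_prob(1)[OF M X v])
  moreover have "sc_cdf \<rho> a \<le> sc_cdf \<rho> b \<longleftrightarrow> a \<le> b" for a b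
    using sc_cdf_strict_mono[OF \<rho>, of a b] sc_cdf_strict_mono[OF \<rho>, of b a]
    by (cases a b rule: linorder_cases) auto
  ultimately have "\<P>(\<omega> in M. u \<bullet> X \<omega> \<le> c) \<ge> 1 / 2 + \<theta> / pi \<longleftrightarrow> \<rho> / cos \<theta> + tan \<theta> \<le> c / norm u"
    by (simp only: sc_cdf_quantile[OF \<rho> \<theta>, symmetric])
  also have "\<dots> \<longleftrightarrow> (\<rho> / cos \<theta> + tan \<theta>) * norm u \<le> c"
    using n by (rule pos_le_divide_eq)
  also have "(\<rho> / cos \<theta> + tan \<theta>) * norm u = u $ k * (\<gamma> / sqrt (1 + \<gamma>\<^sup>2) / cos \<theta>) + norm u * tan \<theta>"
    using n by (simp add: \<rho>_def v_def distrib_right)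
  finally show ?thesis .
qed

section \<open>From half-spaces to the ball\<close>

text \<open>A closed ball is the intersection of its supporting half-spaces: points of the ball
  satisfy every inequality by Cauchy-Schwarz, and a point outside violates the one in its own
  direction from the centre.\<close>

lemma halfspaces_Inter_cball:
  fixes z :: "'a::real_inner"
  assumes t: "t \<ge> 0"
  shows "{x. \<forall>u c. u \<noteq> 0 \<and> u \<bullet> z + norm u * t \<le> c \<longrightarrow> u \<bullet> x \<le> c} = cball z t"
proof (intro set_eqI iffI)
  fix x assume x: "x \<in> {x. \<forall>u c. u \<noteq> 0 \<and> u \<bullet> z + norm u * t \<le> c \<longrightarrow> u \<bullet> x \<le> c}"
  show "x \<in> cball z t"
  proof (cases "x = z")
    case False
    then have n: "norm (x - z) > 0" by simp
    \<comment> \<open>The test direction is \<open>x - z\<close>, with the smallest admissible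
      \<open>c\<close>.\<close>
    have "(x - z) \<bullet> x \<le> (x - z) \<bullet> z + norm (x - z) * t"
      using x False by auto
    then have "norm (x - z) * norm (x - z) \<le> norm (x - z) * t"
      by (simp add: inner_diff_right power2_norm_eq_inner flip: power2_eq_square)
    then show ?thesis
      using n by (simp add: dist_norm norm_minus_commute)
  qed (use t in simp)
next
  fix x assume "x \<in> cball z t"
  then have x: "norm (x - z) \<le> t" by (simp add: dist_norm norm_minus_commute)
  have "u \<bullet> x \<le> u \<bullet> z + norm u * t" for u
  proof -
    have "u \<bullet> (x - z) \<le> norm u * norm (x - z)" by (rule norm_cauchy_schwarz)
    also have "\<dots> \<le> norm u * t" using x by (intro mult_left_mono) auto
    finally show ?thesis by (simp add: inner_diff_right)
  qed
  then show "x \<in> {x. \<forall>u c. u \<noteq> 0 \<and> u \<bullet> z + norm u * t \<le> c \<longrightarrow> u \<bullet> x \<le> c}"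
    using order_trans by blast
qed

theorem theorem4p3:
  fixes M :: "'w measure" and X :: "'w \<Rightarrow> real ^ 'n::finite"
    and k :: 'n and \<gamma> \<alpha> :: real
  assumes "prob_space M"
    and "distributed M lborel X (\<lambda>x. ennreal (csc_density k \<gamma> x))"
    and "0 < \<alpha>" and "\<alpha> \<le> 1 / 2"
  shows "depth_set M X \<alpha> =
    (let s = \<gamma> / sqrt (1 + \<gamma>\<^sup>2) * (1 / cos ((1 / 2 - \<alpha>) * pi));
         t = tan ((1 / 2 - \<alpha>) * pi)
     in {x. (x $ k - s)\<^sup>2 + (\<Sum>i\<in>UNIV - {k}. (x $ i)\<^sup>2) \<le> t\<^sup>2})"
proof -
  \<comment> \<open>In terms of this angle the level \<open>1 - \<alpha>\<close> is
    \<open>1 / 2 + \<theta> / pi\<close>, as in the quantile formula, and \<alpha> in (0, 1/2]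
    corresponds to \<theta> in [0, pi/2).\<close>
  define \<theta> where "\<theta> = (1 / 2 - \<alpha>) * pi"
  define s where "s = \<gamma> / sqrt (1 + \<gamma>\<^sup>2) / cos \<theta>"
  define t where "t = tan \<theta>"
  define z where "z = s *\<^sub>R (axis k 1 :: real ^ 'n)"
  have \<theta>: "0 \<le> \<theta>" "\<theta> < pi / 2" and level: "1 - \<alpha> = 1 / 2 + \<theta> / pi"
    using assms(3,4) by (auto simp: \<theta>_def field_simps)
  have t: "t \<ge> 0"
    unfolding t_def using \<theta> by (cases "\<theta> = 0") (auto intro!: less_imp_le tan_gt_zero)
  have uz: "u \<bullet> z = u $ k * s" for u
    by (simp add: z_def inner_axis)
  have quantile: "1 / 2 + \<theta> / pi \<le> \<P>(\<omega> in M. u \<bullet> X \<omega> \<le> c) \<longleftrightarrow> u \<bullet> z + norm u * t \<le> c"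
    if "u \<noteq> 0" for u c
    unfolding uz s_def t_def by (rule csc_halfspace_quantile[OF assms(1,2) that \<theta>])
  \<comment> \<open>For nonzero \<open>u\<close> every offset \<open>c\<close> is attained at some
    boundary point \<open>y\<close>, so quantifying over half-spaces through \<open>y\<close> or
    over offsets gives the same intersection.\<close>
  have ex: "\<exists>y. u \<bullet> y = c" if "u \<noteq> 0" for u :: "real ^ 'n" and c
    using that by (intro exI[of _ "(c / (u \<bullet> u)) *\<^sub>R u"]) simp
  have "depth_set M X \<alpha> =
    {x. \<forall>u y. u \<noteq> 0 \<and> 1 / 2 + \<theta> / pi \<le> \<P>(\<omega> in M. u \<bullet> X \<omega> \<le> u \<bullet> y) \<longrightarrow> u \<bullet> x \<le> u \<bullet> y}"
  proof -
    have "\<Inter> {f y u | y u. P y u} = {x. \<forall>u y. P y u \<longrightarrow> x \<in> f y u}"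
      for f :: "real ^ 'n \<Rightarrow> real ^ 'n \<Rightarrow> (real ^ 'n) set" and P
      by blast
    then show ?thesis
      by (simp only: depth_set_def halfspace_def level mem_Collect_eq)
  qed
  also have "\<dots> =
    {x. \<forall>u y. u \<noteq> 0 \<and> u \<bullet> z + norm u * t \<le> u \<bullet> y \<longrightarrow> u \<bullet> x \<le> u \<bullet> y}"
    by (simp only: quantile simp_thms cong: conj_cong)
  also have "\<dots> = {x. \<forall>u c. u \<noteq> 0 \<and> u \<bullet> z + norm u * t \<le> c \<longrightarrow> u \<bullet> x \<le> c}"
    using ex by (intro Collect_cong) metis
  also have "\<dots> = cball z t"
    by (rule halfspaces_Inter_cball[OF t])
  also have "\<dots> = {x. (x $ k - s)\<^sup>2 + (\<Sum>i\<in>UNIV - {k}. (x $ i)\<^sup>2) \<le> t\<^sup>2}"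
  proof (intro set_eqI)
    fix x
    have "(norm (x - z))\<^sup>2 = (\<Sum>i\<in>UNIV. ((x - z) $ i)\<^sup>2)"
      by (simp add: norm_vec_def L2_set_def sum_nonneg)
    also have "\<dots> = ((x - z) $ k)\<^sup>2 + (\<Sum>i\<in>UNIV - {k}. ((x - z) $ i)\<^sup>2)"
      by (rule sum.remove) auto
    also have "\<dots> = (x $ k - s)\<^sup>2 + (\<Sum>i\<in>UNIV - {k}. (x $ i)\<^sup>2)"
      by (intro arg_cong2[where f = "(+)"] sum.cong) (auto simp: z_def axis_def)
    finally have eq: "(norm (x - z))\<^sup>2 = (x $ k - s)\<^sup>2 + (\<Sum>i\<in>UNIV - {k}. (x $ i)\<^sup>2)" .
    have "x \<in> cball z t \<longleftrightarrow> norm (x - z) \<le> t"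
      by (simp add: dist_norm norm_minus_commute)
    also have "\<dots> \<longleftrightarrow> (norm (x - z))\<^sup>2 \<le> t\<^sup>2"
      using t by (intro power_mono_iff[symmetric]) auto
    finally show "x \<in> cball z t \<longleftrightarrow> x \<in> {x. (x $ k - s)\<^sup>2 + (\<Sum>i\<in>UNIV - {k}. (x $ i)\<^sup>2) \<le> t\<^sup>2}"
      unfolding eq mem_Collect_eq .
  qed
  finally show ?thesis
    by (simp add: Let_def s_def t_def \<theta>_def)
qed

end
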